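(* Fix $k\geq1$. Let $d$ be a partial computable coloring $[\omega]^2\to k$ and let $\Psi$ be a Turing functional. There exists a computable coloring $e:\omega\to\#(k)$ such that if $d$ is total and stable, then $d$ has an infinite homogeneous set $H$ for which $\Psi^H$ is not (the characteristic function of) an infinite almost-homogeneous set for $e$. Moreover, an index for $e$ can be obtained uniformly computably from $k$, an index for $d$ as a partial computable function, and an index for $\Psi$.
   Context: The function $\#:\omega\to\omega$ is defined by $\#(0)=1$ and $\#(k)=(k+1)\cdot\#(k-1)^k$ for $k\ge1$ (so $\#(1)=2$, $\#(2)=12$). A coloring $d:[\omega]^2\to k$ ($k=\{0,\ldots,k-1\}$) is stable if $\lim_y d(x,y)$ exists for each $x$; $H$ is homogeneous for $d$ if $d$ is constant on $[H]^2$. A set $A$ is almost-homogeneous for $e:\omega\to m$ if there is $i<m$ with $e(x)=i$ for all but finitely many $x\in A$. *)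

theory Defs
  imports Main "HOL-Library.Nat_Bijection" "HOL-Library.Indicator_Function" "HOL-Library.Ramsey"
begin

text \<open>
  Oracle computability is Kleene's: the functions partial recursive in an oracle are generated from
  zero, successor, projections and the characteristic function of the oracle by composition,
  primitive recursion and minimization.  All functions are unary; several arguments are
  passed through the pairing bijection \<^const>\<open>prod_encode\<close>.
\<close>

datatype code =
    CZero | CSucc | CFst | CSnd | COracle
  | CPair code code | CComp code code | CPrec code code | CMu code

primrec run :: "nat set \<Rightarrow> code \<Rightarrow> nat \<rightharpoonup> nat" where
  "run X CZero n = Some 0"
| "run X CSucc n = Some (Suc n)"
| "run X CFst n = Some (fst (prod_decode n))"
| "run X CSnd n = Some (snd (prod_decode n))"
| "run X COracle n = Some (indicator X n)"
| "run X (CPair f g) n =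
     Option.bind (run X f n) (\<lambda>u. Option.bind (run X g n) (\<lambda>v. Some (prod_encode (u, v))))"
| "run X (CComp f g) n = Option.bind (run X g n) (run X f)"
| "run X (CPrec f g) n =
     (case prod_decode n of (u, m) \<Rightarrow>
       rec_nat (run X f u)
         (\<lambda>j r. Option.bind r (\<lambda>v. run X g (prod_encode (u, prod_encode (j, v))))) m)"
| "run X (CMu f) n =
     (if \<exists>m. run X f (prod_encode (n, m)) = Some 0 \<and>
             (\<forall>j<m. run X f (prod_encode (n, j)) \<noteq> None)
      then Some (LEAST m. run X f (prod_encode (n, m)) = Some 0)
      else None)"

lemma prod_encode_less_snd: "0 < t \<Longrightarrow> m < prod_encode (t, m)"
  by (induction t) (auto simp: prod_encode_def)

lemma decode_termination:
  assumes "(t, m) = prod_decode n" "t \<noteq> 0" "(u, v) = prod_decode m"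
  shows "u < n" "v < n" "m < n"
proof -
  have n: "n = prod_encode (t, m)" and m: "m = prod_encode (u, v)"
    using assms(1,3) by (metis prod_decode_inverse)+
  show "m < n"
    using prod_encode_less_snd[of t m] assms(2) n by simp
  then show "u < n" "v < n"
    using le_prod_encode_1[of u v] le_prod_encode_2[of v u] m by auto
qed

text \<open>
  A Goedel numbering in which every natural number is an index; \<^term>\<open>t\<close> is the tag of
  the outermost constructor.
\<close>

function decode :: "nat \<Rightarrow> code" where
  "decode n =
    (let (t, m) = prod_decode n; (u, v) = prod_decode m in
     if t = 0 then CZero
     else if t = 1 then CSucc
     else if t = 2 then CFst
     else if t = 3 then CSnd
     else if t = 4 then COracle
     else if t = 5 then CPair (decode u) (decode v)
     else if t = 6 then CComp (decode u) (decode v)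
     else if t = 7 then CPrec (decode u) (decode v)
     else CMu (decode m))"
  by pat_completeness auto
termination
  by (relation "measure id") (auto dest: decode_termination)

declare decode.simps [simp del]

definition Phi :: "nat \<Rightarrow> nat set \<Rightarrow> nat \<rightharpoonup> nat" where
  "Phi i X = run X (decode i)"

definition turing_functional_index :: "nat \<Rightarrow> (nat set \<Rightarrow> nat \<rightharpoonup> nat) \<Rightarrow> bool" where
  "turing_functional_index p \<Psi> \<longleftrightarrow> Phi p = \<Psi>"

definition computable_index :: "nat \<Rightarrow> (nat \<Rightarrow> nat) \<Rightarrow> bool" where
  "computable_index i f \<longleftrightarrow> Phi i {} = (\<lambda>n. Some (f n))"

definition computable3 :: "(nat \<Rightarrow> nat \<Rightarrow> nat \<Rightarrow> nat) \<Rightarrow> bool" where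
  "computable3 h \<longleftrightarrow>
     (\<exists>i. \<forall>a b c. Phi i {} (prod_encode (a, prod_encode (b, c))) = Some (h a b c))"

text \<open>
  Colorings of pairs live on the two-element sets \<^term>\<open>nsets (UNIV :: nat set) 2\<close>;
  an index computes the color of \<^term>\<open>{x, y}\<close> from the pair coded with the smaller
  element first, and its behaviour on other inputs is irrelevant.
\<close>

definition partial_coloring :: "nat \<Rightarrow> (nat set \<rightharpoonup> nat) \<Rightarrow> bool" where
  "partial_coloring k d \<longleftrightarrow> dom d \<subseteq> nsets UNIV 2 \<and> ran d \<subseteq> {..<k}"

definition coloring_index :: "nat \<Rightarrow> (nat set \<rightharpoonup> nat) \<Rightarrow> bool" where
  "coloring_index a d \<longleftrightarrow> (\<forall>x y. x < y \<longrightarrow> Phi a {} (prod_encode (x, y)) = d {x, y})"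

definition total_coloring :: "(nat set \<rightharpoonup> nat) \<Rightarrow> bool" where
  "total_coloring d \<longleftrightarrow> dom d = nsets UNIV 2"

definition stable_coloring :: "(nat set \<rightharpoonup> nat) \<Rightarrow> bool" where
  "stable_coloring d \<longleftrightarrow> (\<forall>x. \<exists>c. \<forall>\<^sub>F y in sequentially. d {x, y} = Some c)"

definition homogeneous :: "(nat set \<rightharpoonup> nat) \<Rightarrow> nat set \<Rightarrow> bool" where
  "homogeneous d H \<longleftrightarrow> (\<exists>c. \<forall>s \<in> nsets H 2. d s = Some c)"

definition almost_homogeneous :: "nat \<Rightarrow> (nat \<Rightarrow> nat) \<Rightarrow> nat set \<Rightarrow> bool" where
  "almost_homogeneous m e A \<longleftrightarrow> (\<exists>i<m. finite {x \<in> A. e x \<noteq> i})"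

primrec sharp :: "nat \<Rightarrow> nat" where
  "sharp 0 = 1"
| "sharp (Suc k) = (Suc k + 1) * sharp k ^ Suc k"

end

theory Submission
  imports Defs
begin

text \<open>
  Let \<open>A\<^sub>j\<close> be the set of points with limit color \<open>j\<close>.  The coloring \<open>e\<close> is a product of \<open>k\<close>
  colorings \<open>e\<^sub>l\<close> with \<open>k + 1\<close> colors each, which is affordable as \<open>(k + 1)^k \<le> #(k)\<close>.  Component 0
  proceeds in rounds, and in round \<open>m\<close> it takes the value \<open>m mod (k + 1)\<close>.  A round ends as soon as
  every partition of the points into \<open>k\<close> parts, if it agrees with the current guess at the \<open>A\<^sub>j\<close> on
  the part already used, has for some \<open>j\<close> a finite extension, inside its \<open>j\<close>-th part, of the current
  homogeneous set of color \<open>j\<close> that forces the functional to return 1 at a large number of color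
  \<open>m mod (k + 1)\<close>.  If all rounds end, then the true partition provides such an extension in every
  round.  There are \<open>k + 1\<close> residues but only \<open>k\<close> colors \<open>j\<close>, so for some \<open>j\<close> the set that is
  built inside \<open>A\<^sub>j\<close> is infinite and the set computed from it is not almost homogeneous.

  If a round never ends, then by compactness there is a partition \<open>P\<^sub>0\<close> without such extensions.  If its
  \<open>j\<close>-th part has infinite intersection with \<open>A\<^sub>j\<close>, then this intersection yields a homogeneous set
  from which no infinite set is computed.  Otherwise \<open>P\<^sub>0\<close> differs from the true partition at almost every point.
  Component \<open>l\<close> of \<open>e\<close> therefore considers only partitions that differ almost everywhere from
  barren partitions \<open>P\<^sub>0, \<dots>, P\<^sub>l\<^sub>-\<^sub>1\<close> of the lower levels.  Not all \<open>k\<close> levels can be stuck without a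
  win, since \<open>k + 1\<close> partitions into \<open>k\<close> parts cannot differ pairwise at a point.
\<close>

subsection \<open>Computable functions and decidable predicates\<close>

abbreviation pe :: "nat \<Rightarrow> nat \<Rightarrow> nat" where "pe a b \<equiv> prod_encode (a, b)"
abbreviation pfst :: "nat \<Rightarrow> nat" where "pfst z \<equiv> fst (prod_decode z)"
abbreviation psnd :: "nat \<Rightarrow> nat" where "psnd z \<equiv> snd (prod_decode z)"

text \<open>One code must serve every oracle and always converge, so the closure proofs need no
  bookkeeping of oracles or divergence.\<close>

definition recfn :: "(nat \<Rightarrow> nat) \<Rightarrow> bool" where
  "recfn f \<longleftrightarrow> (\<exists>c. \<forall>X n. run X c n = Some (f n))"

definition decpred :: "(nat \<Rightarrow> bool) \<Rightarrow> bool" where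
  "decpred P \<longleftrightarrow> recfn (\<lambda>z. of_bool (P z))"

named_theorems rec_intros

lemma recfnI: "(\<And>X n. run X c n = Some (f n)) \<Longrightarrow> recfn f"
  unfolding recfn_def by blast

lemma recfn_id [rec_intros]: "recfn (\<lambda>z. z)"
  by (rule recfnI[of "CPair CFst CSnd"]) simp

lemma recfn_compose:
  assumes "recfn f" "recfn g" shows "recfn (\<lambda>z. f (g z))"
proof -
  obtain c d where "\<And>X n. run X c n = Some (f n)" "\<And>X n. run X d n = Some (g n)"
    using assms unfolding recfn_def by blast
  then show ?thesis by (intro recfnI[of "CComp c d"]) simp
qed

lemma recfn_Suc [rec_intros]: "recfn f \<Longrightarrow> recfn (\<lambda>z. Suc (f z))"
  by (rule recfn_compose[of Suc f], rule recfnI[of CSucc]) simp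

lemma recfn_pfst [rec_intros]: "recfn f \<Longrightarrow> recfn (\<lambda>z. pfst (f z))"
  by (rule recfn_compose[of pfst f], rule recfnI[of CFst]) simp

lemma recfn_psnd [rec_intros]: "recfn f \<Longrightarrow> recfn (\<lambda>z. psnd (f z))"
  by (rule recfn_compose[of psnd f], rule recfnI[of CSnd]) simp

lemma recfn_const [rec_intros]: "recfn (\<lambda>z. c)"
proof (induction c)
  case 0
  show ?case by (rule recfnI[of CZero]) simp
next
  case (Suc c)
  then show ?case by (rule recfn_Suc)
qed

lemma recfn_pe [rec_intros]:
  assumes "recfn f" "recfn g" shows "recfn (\<lambda>z. pe (f z) (g z))"
proof -
  obtain c d where "\<And>X n. run X c n = Some (f n)" "\<And>X n. run X d n = Some (g n)"
    using assms unfolding recfn_def by blast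
  then show ?thesis by (intro recfnI[of "CPair c d"]) simp
qed

lemma recfn_lift2:
  assumes "recfn (\<lambda>z. F (pfst z) (psnd z))" "recfn f" "recfn g"
  shows "recfn (\<lambda>z. F (f z) (g z))"
  using recfn_compose[OF assms(1) recfn_pe[OF assms(2,3)]] by simp

lemma recfn_rec [rec_intros]:
  assumes "recfn b" "recfn f" "recfn (\<lambda>z. g (pfst z) (pfst (psnd z)) (psnd (psnd z)))"
  shows "recfn (\<lambda>z. rec_nat (f z) (g z) (b z))"
proof -
  obtain c d where c: "\<And>X n. run X c n = Some (f n)"
    and d: "\<And>X n. run X d n = Some (g (pfst n) (pfst (psnd n)) (psnd (psnd n)))"
    using assms(2,3) unfolding recfn_def by blast
  have "rec_nat (run X c u) (\<lambda>j r. Option.bind r (\<lambda>v. run X d (pe u (pe j v)))) m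
      = Some (rec_nat (f u) (g u) m)" for X u m
    by (induction m) (simp_all add: c d)
  then have "recfn (\<lambda>z. rec_nat (f (pfst z)) (g (pfst z)) (psnd z))"
    by (intro recfnI[of "CPrec c d"]) (simp split: prod.split)
  from recfn_compose[OF this recfn_pe[OF recfn_id assms(1)]] show ?thesis by simp
qed

lemma recfn_add [rec_intros]:
  assumes "recfn f" "recfn g" shows "recfn (\<lambda>z. f z + g z)"
proof -
  have *: "a + b = rec_nat a (\<lambda>_ v. Suc v) b" for a b :: nat by (induction b) simp_all
  show ?thesis unfolding * by (intro rec_intros assms)
qed

lemma recfn_mult [rec_intros]:
  assumes "recfn f" "recfn g" shows "recfn (\<lambda>z. f z * g z)"
proof (rule recfn_lift2[OF _ assms])
  have *: "a * b = rec_nat 0 (\<lambda>_ v. v + a) b" for a b :: nat by (induction b) simp_all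
  show "recfn (\<lambda>z. pfst z * psnd z)" unfolding * by (intro rec_intros)
qed

lemma recfn_power [rec_intros]:
  assumes "recfn f" "recfn g" shows "recfn (\<lambda>z. f z ^ g z)"
proof (rule recfn_lift2[OF _ assms])
  have *: "a ^ b = rec_nat 1 (\<lambda>_ v. a * v) b" for a b :: nat by (induction b) simp_all
  show "recfn (\<lambda>z. pfst z ^ psnd z)" unfolding * by (intro rec_intros)
qed

lemma recfn_pred: "recfn f \<Longrightarrow> recfn (\<lambda>z. f z - 1)"
proof -
  assume f: "recfn f"
  have *: "rec_nat 0 (\<lambda>j _. j) v = v - 1" for v :: nat by (cases v) simp_all
  have "recfn (\<lambda>z. rec_nat 0 (\<lambda>j _. j) (f z))"
    by (rule recfn_rec[OF f recfn_const recfn_pfst[OF recfn_psnd[OF recfn_id]]])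
  then show ?thesis by (simp only: *)
qed

lemma recfn_diff [rec_intros]:
  assumes "recfn f" "recfn g" shows "recfn (\<lambda>z. f z - g z)"
proof -
  have *: "rec_nat a (\<lambda>_ v. v - 1) b = a - b" for a b :: nat by (induction b) simp_all
  have "recfn (\<lambda>z. rec_nat (f z) (\<lambda>_ v. v - 1) (g z))"
    by (rule recfn_rec[OF assms(2,1) recfn_pred[OF recfn_psnd[OF recfn_psnd[OF recfn_id]]]])
  then show ?thesis by (simp only: *)
qed

lemma recfn_of_bool: "decpred P \<Longrightarrow> recfn (\<lambda>z. of_bool (P z))"
  by (simp add: decpred_def)

lemma decpred_eq_0: assumes "recfn f" shows "decpred (\<lambda>z. f z = 0)"
proof -
  have *: "of_bool (a = 0) = 1 - (a::nat)" for a by simp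
  show ?thesis unfolding decpred_def * by (intro rec_intros assms)
qed

lemma decpred_not [rec_intros]: assumes "decpred P" shows "decpred (\<lambda>z. \<not> P z)"
  using decpred_eq_0[OF recfn_of_bool[OF assms]] by simp

lemma decpred_conj [rec_intros]:
  assumes "decpred P" "decpred Q" shows "decpred (\<lambda>z. P z \<and> Q z)"
  using recfn_mult[OF recfn_of_bool[OF assms(1)] recfn_of_bool[OF assms(2)]]
  by (simp add: decpred_def of_bool_conj)

lemma decpred_disj [rec_intros]:
  assumes "decpred P" "decpred Q" shows "decpred (\<lambda>z. P z \<or> Q z)"
proof -
  have "decpred (\<lambda>z. \<not> (\<not> P z \<and> \<not> Q z))" by (intro rec_intros assms)
  then show ?thesis by simp
qed

lemma decpred_imp [rec_intros]:
  assumes "decpred P" "decpred Q" shows "decpred (\<lambda>z. P z \<longrightarrow> Q z)"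
proof -
  have "decpred (\<lambda>z. \<not> P z \<or> Q z)" by (intro rec_intros assms)
  then show ?thesis by simp
qed

lemma decpred_iff [rec_intros]:
  assumes "decpred P" "decpred Q" shows "decpred (\<lambda>z. P z \<longleftrightarrow> Q z)"
proof -
  have *: "(P z \<longleftrightarrow> Q z) \<longleftrightarrow> (P z \<longrightarrow> Q z) \<and> (Q z \<longrightarrow> P z)" for z by blast
  show ?thesis unfolding * by (intro rec_intros assms)
qed

lemma decpred_le [rec_intros]:
  assumes "recfn f" "recfn g" shows "decpred (\<lambda>z. f z \<le> g z)"
  using decpred_eq_0[OF recfn_diff[OF assms]] by simp

lemma decpred_less [rec_intros]:
  assumes "recfn f" "recfn g" shows "decpred (\<lambda>z. f z < g z)"
  using decpred_not[OF decpred_le[OF assms(2,1)]] by (simp add: not_le)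

lemma decpred_eq [rec_intros]:
  assumes "recfn f" "recfn g" shows "decpred (\<lambda>z. f z = g z)"
  using decpred_conj[OF decpred_le[OF assms] decpred_le[OF assms(2,1)]]
  by (simp flip: order_eq_iff)

lemma decpred_lift: "decpred P \<Longrightarrow> recfn f \<Longrightarrow> decpred (\<lambda>z. P (f z))"
  unfolding decpred_def by (rule recfn_compose)

lemma decpred_ball [rec_intros]:
  assumes "recfn b" "decpred (\<lambda>z. P (pfst z) (psnd z))"
  shows "decpred (\<lambda>z. \<forall>y<b z. P z y)"
proof -
  have *: "of_bool (\<forall>y<n. Q y) = rec_nat (1::nat) (\<lambda>y v. v * of_bool (Q y)) n" for Q n
  proof (induction n)
    case (Suc n)
    have "(\<forall>y<Suc n. Q y) \<longleftrightarrow> (\<forall>y<n. Q y) \<and> Q n" by (auto simp: less_Suc_eq)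
    then show ?case by (simp only: of_bool_conj Suc.IH nat.rec)
  qed simp
  have "decpred (\<lambda>z. P (pfst z) (pfst (psnd z)))"
    using decpred_lift[OF assms(2), of "\<lambda>z. pe (pfst z) (pfst (psnd z))"]
    by (simp add: rec_intros)
  then show ?thesis
    unfolding decpred_def * by (intro rec_intros assms(1))
qed

lemma decpred_bex [rec_intros]:
  assumes "recfn b" "decpred (\<lambda>z. P (pfst z) (psnd z))"
  shows "decpred (\<lambda>z. \<exists>y<b z. P z y)"
proof -
  have "decpred (\<lambda>z. \<not> (\<forall>y<b z. \<not> P z y))" by (intro rec_intros assms)
  then show ?thesis by simp
qed

lemma recfn_if [rec_intros]:
  assumes "decpred P" "recfn f" "recfn g"
  shows "recfn (\<lambda>z. if P z then f z else g z)"
proof -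
  have *: "(if Q then a else b) = of_bool Q * a + (1 - of_bool Q) * b" for Q and a b :: nat
    by simp
  show ?thesis unfolding * by (intro rec_intros recfn_of_bool assms)
qed

lemma recfn_Least:
  assumes "decpred (\<lambda>z. P (pfst z) (psnd z))" and ex: "\<And>z. \<exists>y. P z y"
  shows "recfn (\<lambda>z. LEAST y. P z y)"
proof -
  \<comment> \<open>Minimization looks for a zero, hence the negation.\<close>
  have "recfn (\<lambda>z. of_bool (\<not> P (pfst z) (psnd z)))"
    by (intro recfn_of_bool rec_intros assms)
  then obtain c where c: "\<And>X n. run X c n = Some (of_bool (\<not> P (pfst n) (psnd n)))"
    unfolding recfn_def by blast
  have "run X (CMu c) n = Some (LEAST y. P n y)" for X n
    using ex[of n] by (auto simp: c)
  then show ?thesis by (rule recfnI)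
qed

lemma recfn_div [rec_intros]:
  assumes "recfn f" "recfn g" shows "recfn (\<lambda>z. f z div g z)"
proof -
  \<comment> \<open>The disjunct \<open>b = 0\<close> makes the search total and yields 0, the value
    of division by zero.\<close>
  have *: "a div b = (LEAST q. b = 0 \<or> a < b * Suc q)" for a b :: nat
  proof (rule sym, rule Least_equality)
    show "b = 0 \<or> a < b * Suc (a div b)"
      using dividend_less_times_div[of b a] by auto
  next
    fix q assume "b = 0 \<or> a < b * Suc q"
    then show "a div b \<le> q"
      by (metis div_by_0 le0 less_Suc_eq_le less_mult_imp_div_less mult.commute)
  qed
  show ?thesis
  proof (rule recfn_lift2[OF _ assms])
    have "\<exists>q. b = 0 \<or> a < b * Suc q" for a b :: nat
      by (metis dividend_less_times_div mult_Suc_right not_gr0)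
    then show "recfn (\<lambda>z. pfst z div psnd z)"
      unfolding * by (intro recfn_Least rec_intros)
  qed
qed

lemma recfn_mod [rec_intros]:
  assumes "recfn f" "recfn g" shows "recfn (\<lambda>z. f z mod g z)"
  unfolding modulo_nat_def by (intro rec_intros assms)

lemma decpred_set_decode [rec_intros]:
  assumes "recfn f" "recfn g" shows "decpred (\<lambda>z. f z \<in> set_decode (g z))"
  unfolding set_decode_def mem_Collect_eq odd_iff_mod_2_eq_one by (intro rec_intros assms)

lemma set_encode_Suc:
  "set_encode {y. y < Suc n \<and> P y} = set_encode {y. y < n \<and> P y} + (if P n then 2 ^ n else 0)"
proof (cases "P n")
  case True
  then have "{y. y < Suc n \<and> P y} = insert n {y. y < n \<and> P y}" by auto
  then show ?thesis using True by simp
next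
  case False
  then have "{y. y < Suc n \<and> P y} = {y. y < n \<and> P y}" by (auto simp: less_Suc_eq)
  then show ?thesis using False by simp
qed

lemma recfn_set_encode [rec_intros]:
  assumes "recfn b" "decpred (\<lambda>z. P (pfst z) (psnd z))"
  shows "recfn (\<lambda>z. set_encode {y. y < b z \<and> P z y})"
proof -
  have *: "set_encode {y. y < n \<and> Q y} = rec_nat 0 (\<lambda>y v. v + (if Q y then 2 ^ y else 0)) n" for Q n
    by (induction n) (simp_all add: set_encode_Suc)
  have "decpred (\<lambda>z. P (pfst z) (pfst (psnd z)))"
    using decpred_lift[OF assms(2), of "\<lambda>z. pe (pfst z) (pfst (psnd z))"]
    by (simp add: rec_intros)
  then show ?thesis unfolding * by (intro rec_intros assms(1))
qed

lemma recfn_sum [rec_intros]: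
  assumes "recfn b" "recfn (\<lambda>z. f (pfst z) (psnd z))"
  shows "recfn (\<lambda>z. \<Sum>y<b z. f z y)"
proof -
  have *: "(\<Sum>y<n. g y) = rec_nat (0::nat) (\<lambda>y v. v + g y) n" for g n
    by (induction n) simp_all
  have "recfn (\<lambda>z. f (pfst z) (pfst (psnd z)))"
    using recfn_compose[OF assms(2), of "\<lambda>z. pe (pfst z) (pfst (psnd z))"]
    by (simp add: rec_intros)
  then show ?thesis unfolding * by (intro rec_intros assms(1))
qed

text \<open>A list is coded by iterated pairing, so that \<open>look\<close> counts from its most recent entry.\<close>

definition look :: "nat \<Rightarrow> nat \<Rightarrow> nat" where
  "look L n = pfst (rec_nat L (\<lambda>_. psnd) n)"

lemma recfn_look [rec_intros]: "recfn f \<Longrightarrow> recfn g \<Longrightarrow> recfn (\<lambda>z. look (f z) (g z))"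
  unfolding look_def by (intro rec_intros)

primrec history :: "(nat \<Rightarrow> nat \<Rightarrow> nat) \<Rightarrow> nat \<Rightarrow> nat" where
  "history G 0 = 0"
| "history G (Suc n) = pe (G n (history G n)) (history G n)"

lemma recfn_history [rec_intros]:
  assumes "recfn b" "recfn (\<lambda>z. G (pfst z) (pfst (psnd z)) (psnd (psnd z)))"
  shows "recfn (\<lambda>z. history (G z) (b z))"
proof -
  have *: "history H n = rec_nat 0 (\<lambda>i r. pe (H i r) r) n" for H n
    by (induction n) simp_all
  show ?thesis unfolding * by (intro rec_intros assms)
qed

lemma look_history: "i < n \<Longrightarrow> look (history G n) (n - Suc i) = G i (history G i)"
proof (induction n)
  case (Suc n)
  have step: "look (pe a L) (Suc m) = look L m" for a L m
  proof -
    have "rec_nat (pe a L) (\<lambda>_. psnd) (Suc m) = rec_nat L (\<lambda>_. psnd) m"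
      by (induction m) simp_all
    then show ?thesis by (simp add: look_def)
  qed
  show ?case
  proof (cases "i = n")
    case True
    then show ?thesis by (simp add: look_def)
  next
    case False
    then have "Suc n - Suc i = Suc (n - Suc i)" "i < n" using Suc.prems by auto
    with Suc.IH show ?thesis by (simp add: step del: diff_Suc_Suc)
  qed
qed simp

subsection \<open>Indices and computation tables\<close>

declare recfn_of_bool [rec_intros]

lemma decpred_lift2:
  assumes "decpred (\<lambda>z. P (pfst z) (psnd z))" "recfn f" "recfn g"
  shows "decpred (\<lambda>z. P (f z) (g z))"
  using decpred_lift[OF assms(1) recfn_pe[OF assms(2,3)]] by simp

lemma decode_eq:
  "decode i =
    (let t = pfst i; m = psnd i; u = pfst m; w = psnd m in
     if t = 0 then CZero
     else if t = 1 then CSucc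
     else if t = 2 then CFst
     else if t = 3 then CSnd
     else if t = 4 then COracle
     else if t = 5 then CPair (decode u) (decode w)
     else if t = 6 then CComp (decode u) (decode w)
     else if t = 7 then CPrec (decode u) (decode w)
     else CMu (decode m))"
  by (subst decode.simps) (simp add: Let_def split_beta)

lemma decode_subcode_less:
  assumes "pfst i \<noteq> 0"
  shows "psnd i < i" "pfst (psnd i) < i" "psnd (psnd i) < i"
  using decode_termination[of "pfst i" "psnd i" i "pfst (psnd i)" "psnd (psnd i)"] assms by auto

lemma decode_surj: "\<exists>i. decode i = c"
proof (induction c)
  case CZero
  show ?case by (rule exI[of _ "pe 0 0"]) (simp add: decode_eq)
next
  case CSucc
  show ?case by (rule exI[of _ "pe 1 0"]) (simp add: decode_eq)
next
  case CFst
  show ?case by (rule exI[of _ "pe 2 0"]) (simp add: decode_eq)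
next
  case CSnd
  show ?case by (rule exI[of _ "pe 3 0"]) (simp add: decode_eq)
next
  case COracle
  show ?case by (rule exI[of _ "pe 4 0"]) (simp add: decode_eq)
next
  case (CPair f g)
  then obtain u w where "decode u = f" "decode w = g" by blast
  then show ?case by (intro exI[of _ "pe 5 (pe u w)"]) (subst decode_eq, simp add: Let_def)
next
  case (CComp f g)
  then obtain u w where "decode u = f" "decode w = g" by blast
  then show ?case by (intro exI[of _ "pe 6 (pe u w)"]) (subst decode_eq, simp add: Let_def)
next
  case (CPrec f g)
  then obtain u w where "decode u = f" "decode w = g" by blast
  then show ?case by (intro exI[of _ "pe 7 (pe u w)"]) (subst decode_eq, simp add: Let_def)
next
  case (CMu f)
  then obtain u where "decode u = f" by blast
  then show ?case by (intro exI[of _ "pe 8 u"]) (subst decode_eq, simp add: Let_def)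
qed

lemma recfn_computable_index:
  assumes "recfn f" shows "\<exists>i. \<forall>n. Phi i X n = Some (f n)"
  using assms decode_surj unfolding recfn_def Phi_def by metis

text \<open>The s-m-n theorem: \<open>S b\<close> indexes the code of \<open>f\<close> composed with
  the pairing of the constant \<open>b\<close> and the identity.\<close>

lemma recfn_smn:
  assumes "recfn f"
  shows "\<exists>S. recfn S \<and> (\<forall>b X n. Phi (S b) X n = Some (f (pe b n)))"
proof -
  obtain i where i: "\<And>X n. run X (decode i) n = Some (f n)"
    using assms decode_surj unfolding recfn_def by metis
  \<comment> \<open>\<open>C b\<close> is an index of the constant function \<open>b\<close>: the
    successor, with index \<open>pe 1 0\<close>, composed \<open>b\<close> times onto zero.\<close>
  define C where "C = rec_nat (pe 0 0) (\<lambda>_ c. pe 6 (pe (pe 1 0) c))"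
  define S where "S b = pe 6 (pe i (pe 5 (pe (C b) (pe 5 (pe (pe 2 0) (pe 3 0))))))" for b
  have comp: "decode (pe 6 (pe u w)) = CComp (decode u) (decode w)"
    and pair: "decode (pe 5 (pe u w)) = CPair (decode u) (decode w)" for u w
    by (subst decode_eq, simp add: Let_def)+
  have prim: "decode (pe 0 0) = CZero" "decode (pe 1 0) = CSucc"
    "decode (pe 2 0) = CFst" "decode (pe 3 0) = CSnd"
    by (subst decode_eq, simp)+
  have C: "run X (decode (C b)) n = Some b" for X b n
    by (induction b) (simp_all add: C_def comp prim prim[unfolded One_nat_def])
  have "recfn S" unfolding S_def C_def by (intro rec_intros)
  moreover have "Phi (S b) X n = Some (f (pe b n))" for b X n
    by (simp add: Phi_def S_def comp pair prim C i)
  ultimately show ?thesis by blast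
qed

text \<open>
  A computation is recorded by a table of triples \<open>(i, n, v)\<close>, read as ``index \<open>i\<close> returns \<open>v\<close>
  on input \<open>n\<close>'', each of which follows from other triples of the table in one evaluation step.
\<close>

definition justified :: "nat set \<Rightarrow> nat set \<Rightarrow> nat \<Rightarrow> nat \<Rightarrow> nat \<Rightarrow> bool" where
  "justified X T i n v \<longleftrightarrow>
    (let t = pfst i; m = psnd i; u = pfst m; w = psnd m in
       (t = 0 \<and> v = 0) \<or> (t = 1 \<and> v = Suc n) \<or> (t = 2 \<and> v = pfst n) \<or> (t = 3 \<and> v = psnd n) \<or>
       (t = 4 \<and> v = of_bool (n \<in> X)) \<or>
       (t = 5 \<and> pe u (pe n (pfst v)) \<in> T \<and> pe w (pe n (psnd v)) \<in> T) \<or>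
       (t = 6 \<and> (\<exists>q. pe w (pe n q) \<in> T \<and> pe u (pe q v) \<in> T)) \<or>
       (t = 7 \<and> psnd n = 0 \<and> pe u (pe (pfst n) v) \<in> T) \<or>
       (t = 7 \<and> psnd n \<noteq> 0 \<and>
         (\<exists>q. pe i (pe (pe (pfst n) (psnd n - 1)) q) \<in> T \<and>
              pe w (pe (pe (pfst n) (pe (psnd n - 1) q)) v) \<in> T)) \<or>
       (8 \<le> t \<and> pe m (pe (pe n v) 0) \<in> T \<and>
         (\<forall>j<v. \<exists>q. pe m (pe (pe n j) (Suc q)) \<in> T)))"

definition table :: "nat set \<Rightarrow> nat set \<Rightarrow> bool" where
  "table X T \<longleftrightarrow> (\<forall>z\<in>T. justified X T (pfst z) (pfst (psnd z)) (psnd (psnd z)))"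

lemma justified_mono:
  assumes "justified X S i n v" "S \<subseteq> T" shows "justified X T i n v"
  using assms unfolding justified_def Let_def
  by (elim disjE) (auto 0 4)

text \<open>Justifications cannot be circular: each rule refers to smaller indices, except that
  primitive recursion may also refer to its own index with a smaller recursion counter. Hence the
  inner induction in that case.\<close>

lemma table_sound:
  assumes "table X T" "pe i (pe n v) \<in> T"
  shows "run X (decode i) n = Some v"
  using assms(2)
proof (induction i arbitrary: n v rule: less_induct)
  case (less i)
  define t m u w where "t = pfst i" "m = psnd i" "u = pfst m" "w = psnd m"
  note defs = this
  have J: "justified X T i n v" if "pe i (pe n v) \<in> T" for n v
    using assms(1) that unfolding table_def by fastforce
  have sub: "m < i" "u < i" "w < i" if "t \<noteq> 0"
    using decode_subcode_less that by (auto simp: defs)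
  note dec = decode_eq[of i, unfolded Let_def, folded defs]
  consider "t = 0" | "t = 1" | "t = 2" | "t = 3" | "t = 4" | "t = 5" | "t = 6" | "t = 7" | "8 \<le> t"
    by linarith
  then show ?case
  proof cases
    case 6
    then have "pe u (pe n (pfst v)) \<in> T" "pe w (pe n (psnd v)) \<in> T"
      using J[OF less.prems] by (auto simp: justified_def Let_def defs)
    with less.IH sub 6 show ?thesis by (simp add: dec)
  next
    case 7
    then obtain q where "pe w (pe n q) \<in> T" "pe u (pe q v) \<in> T"
      using J[OF less.prems] by (auto simp: justified_def Let_def defs)
    with less.IH sub 7 show ?thesis by (simp add: dec)
  next
    case 8
    have "rec_nat (run X (decode u) x)
        (\<lambda>j r. Option.bind r (\<lambda>v. run X (decode w) (pe x (pe j v)))) y = Some v"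
      if "pe i (pe (pe x y) v) \<in> T" for x y v
      using that
    proof (induction y arbitrary: v)
      case 0
      then have "pe u (pe x v) \<in> T"
        using J[OF 0] 8 by (auto simp: justified_def Let_def defs)
      with less.IH sub 8 show ?case by simp
    next
      case (Suc y)
      then obtain q where "pe i (pe (pe x y) q) \<in> T" "pe w (pe (pe x (pe y q)) v) \<in> T"
        using J[OF Suc.prems] 8 by (auto simp: justified_def Let_def defs)
      with Suc.IH less.IH sub 8 show ?case by simp
    qed
    from this[of "pfst n" "psnd n" v] less.prems 8 show ?thesis by (simp add: dec case_prod_beta)
  next
    case 9
    then have 0: "pe m (pe (pe n v) 0) \<in> T" and q: "\<forall>j<v. \<exists>q. pe m (pe (pe n j) (Suc q)) \<in> T"
      using J[OF less.prems] by (auto simp: justified_def Let_def defs)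
    have r0: "run X (decode m) (pe n v) = Some 0"
      using less.IH[OF _ 0] sub 9 by simp
    have rq: "\<exists>q. run X (decode m) (pe n j) = Some (Suc q)" if "j < v" for j
      using less.IH sub 9 q that by fastforce
    have "(LEAST y. run X (decode m) (pe n y) = Some 0) = v"
    proof (rule Least_equality)
      show "run X (decode m) (pe n v) = Some 0" by (rule r0)
    next
      fix y assume "run X (decode m) (pe n y) = Some 0"
      then show "v \<le> y" using rq[of y] by (cases "y < v") auto
    qed
    moreover have "\<exists>y. run X (decode m) (pe n y) = Some 0 \<and> (\<forall>j<y. run X (decode m) (pe n j) \<noteq> None)"
      using r0 rq by (intro exI[of _ v]) auto
    ultimately show ?thesis using 9 by (simp add: dec)
  qed (use J[OF less.prems] in \<open>auto simp: justified_def Let_def defs dec indicator_def\<close>)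
qed

definition tabulated :: "nat set \<Rightarrow> nat \<Rightarrow> bool" where
  "tabulated X z \<longleftrightarrow> (\<exists>T. finite T \<and> table X T \<and> z \<in> T)"

text \<open>Justification is monotone in the table, so finite tables for finitely many premises can
  be merged and the conclusion added.\<close>

lemma tabulatedI:
  assumes "finite S" "\<And>z. z \<in> S \<Longrightarrow> tabulated X z" "justified X S i n v"
  shows "tabulated X (pe i (pe n v))"
proof -
  obtain F where F: "\<And>z. z \<in> S \<Longrightarrow> finite (F z) \<and> table X (F z) \<and> z \<in> F z"
    using assms(2) unfolding tabulated_def by metis
  define T where "T = insert (pe i (pe n v)) (\<Union>z\<in>S. F z)"
  have "S \<subseteq> T" using F by (auto simp: T_def)
  have "justified X T (pfst z) (pfst (psnd z)) (psnd (psnd z))" if zT: "z \<in> T" for z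
  proof (cases "z = pe i (pe n v)")
    case True
    then show ?thesis using justified_mono[OF assms(3) \<open>S \<subseteq> T\<close>] by simp
  next
    case False
    then obtain y where "y \<in> S" "z \<in> F y" using zT by (auto simp: T_def)
    moreover have "F y \<subseteq> T" using \<open>y \<in> S\<close> by (auto simp: T_def)
    ultimately show ?thesis using F justified_mono unfolding table_def by blast
  qed
  moreover have "finite T" using F assms(1) by (simp add: T_def)
  ultimately show ?thesis unfolding tabulated_def table_def T_def by blast
qed

lemma table_complete:
  assumes "run X (decode i) n = Some v"
  shows "tabulated X (pe i (pe n v))"
  using assms
proof (induction i arbitrary: n v rule: less_induct)
  case (less i)
  define t m u w where "t = pfst i" "m = psnd i" "u = pfst m" "w = psnd m"
  note defs = this
  have sub: "m < i" "u < i" "w < i" if "t \<noteq> 0"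
    using decode_subcode_less that by (auto simp: defs)
  note dec = decode_eq[of i, unfolded Let_def, folded defs]
  consider "t < 5" | "t = 5" | "t = 6" | "t = 7" | "8 \<le> t"
    by linarith
  then show ?case
  proof cases
    case 1
    then have "justified X {} i n v"
      using less.prems by (auto simp: justified_def Let_def dec indicator_def split: if_splits simp flip: defs)
    then show ?thesis by (intro tabulatedI[of "{}"]) auto
  next
    case 2
    then obtain a b where "run X (decode u) n = Some a" "run X (decode w) n = Some b" "v = pe a b"
      using less.prems by (auto simp: dec bind_eq_Some_conv)
    with less.IH sub 2 show ?thesis
      by (intro tabulatedI[of "{pe u (pe n a), pe w (pe n b)}"])
        (auto simp: justified_def Let_def simp flip: defs)
  next
    case 3
    then obtain q where "run X (decode w) n = Some q" "run X (decode u) q = Some v"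
      using less.prems by (auto simp: dec bind_eq_Some_conv)
    with less.IH sub 3 show ?thesis
      by (intro tabulatedI[of "{pe w (pe n q), pe u (pe q v)}"])
        (auto simp: justified_def Let_def simp flip: defs)
  next
    case 4
    have "tabulated X (pe i (pe (pe x y) v))"
      if "rec_nat (run X (decode u) x)
        (\<lambda>j r. Option.bind r (\<lambda>v. run X (decode w) (pe x (pe j v)))) y = Some v" for x y v
      using that
    proof (induction y arbitrary: v)
      case 0
      with less.IH sub 4 show ?case
        by (intro tabulatedI[of "{pe u (pe x v)}"]) (auto simp: justified_def Let_def simp flip: defs)
    next
      case (Suc y)
      then obtain q where "tabulated X (pe i (pe (pe x y) q))" "run X (decode w) (pe x (pe y q)) = Some v"
        by (auto simp: bind_eq_Some_conv)
      with less.IH sub 4 show ?case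
        by (intro tabulatedI[of "{pe i (pe (pe x y) q), pe w (pe (pe x (pe y q)) v)}"])
          (auto simp: justified_def Let_def simp flip: defs)
    qed
    from this[of "pfst n" "psnd n" v] less.prems 4 show ?thesis
      by (simp add: dec case_prod_beta)
  next
    case 5
    define P where "P y \<longleftrightarrow> run X (decode m) (pe n y) = Some 0" for y
    have ex: "\<exists>y. P y \<and> (\<forall>j<y. run X (decode m) (pe n j) \<noteq> None)" and v: "v = (LEAST y. P y)"
      using less.prems 5 by (auto simp: dec P_def split: if_splits)
    then have Pv: "P v" by (auto intro: LeastI)
    have "\<exists>q. run X (decode m) (pe n j) = Some (Suc q)" if "j < v" for j
    proof -
      have "\<not> P j" using that v not_less_Least by blast
      moreover obtain y where "P y" "\<forall>j<y. run X (decode m) (pe n j) \<noteq> None" using ex by blast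
      moreover have "v \<le> y" using \<open>P y\<close> v by (simp add: Least_le)
      ultimately show ?thesis using that not0_implies_Suc unfolding P_def
        by (metis not_Some_eq order_less_le_trans)
    qed
    then obtain q where q: "\<And>j. j < v \<Longrightarrow> run X (decode m) (pe n j) = Some (Suc (q j))" by metis
    show ?thesis
      by (rule tabulatedI[of "insert (pe m (pe (pe n v) 0)) ((\<lambda>j. pe m (pe (pe n j) (Suc (q j)))) ` {..<v})"])
        (use q Pv 5 sub less.IH in \<open>auto simp: justified_def Let_def P_def simp flip: defs\<close>)
  qed
qed

text \<open>The use principle: the oracle is consulted only at inputs of triples in the table, and
  an input is at most the code of its triple.\<close>

lemma table_use:
  assumes "table X T" "\<And>z. z \<in> T \<Longrightarrow> z < q" "\<And>y. y < q \<Longrightarrow> y \<in> X \<longleftrightarrow> y \<in> Y"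
  shows "table Y T"
proof -
  have "justified Y T (pfst z) (pfst (psnd z)) (psnd (psnd z))" if "z \<in> T" for z
  proof -
    have "pfst (psnd z) < q"
      using assms(2)[OF that] le_prod_encode_1[of "pfst (psnd z)" "psnd (psnd z)"]
        le_prod_encode_2[of "psnd z" "pfst z"] by simp
    then have eq: "pfst (psnd z) \<in> X \<longleftrightarrow> pfst (psnd z) \<in> Y" by (rule assms(3))
    have "justified X T (pfst z) (pfst (psnd z)) (psnd (psnd z))"
      using assms(1) that by (simp add: table_def)
    then show ?thesis unfolding justified_def eq .
  qed
  then show ?thesis by (simp add: table_def)
qed

lemma set_decode_less: "x \<in> set_decode T \<Longrightarrow> x < T"
proof -
  assume "x \<in> set_decode T"
  then have "odd (T div 2 ^ x)" by (simp add: set_decode_def)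
  then have "T div 2 ^ x \<noteq> 0" by (metis dvd_0_right)
  then have "2 ^ x \<le> T" by (simp add: div_eq_0_iff)
  then show ?thesis using less_exp[of x] by linarith
qed

lemma pe_mem_less:
  assumes "pe a (pe b c) \<in> set_decode T" shows "a < T" "b < T" "c < T"
  using set_decode_less[OF assms] le_prod_encode_1[of a "pe b c"] le_prod_encode_2[of "pe b c" a]
    le_prod_encode_1[of b c] le_prod_encode_2[of c b] by linarith+

lemma decpred_table [rec_intros]:
  assumes "recfn f" "recfn g"
  shows "decpred (\<lambda>z. table (set_decode (f z)) (set_decode (g z)))"
proof -
  \<comment> \<open>Components of members of a coded set are smaller than its code, so all
    quantifiers can be bounded.\<close>
  have bd: "(\<exists>q. pe a (pe b q) \<in> set_decode T \<and> Q q) \<longleftrightarrow> (\<exists>q<T. pe a (pe b q) \<in> set_decode T \<and> Q q)"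
    "(\<exists>q. pe a (pe b (Suc q)) \<in> set_decode T) \<longleftrightarrow> (\<exists>q<T. pe a (pe b (Suc q)) \<in> set_decode T)"
    for a b T Q using pe_mem_less(3) Suc_lessD by blast+
  have ball: "(\<forall>z\<in>set_decode T. Q z) \<longleftrightarrow> (\<forall>z<T. z \<in> set_decode T \<longrightarrow> Q z)" for T Q
    using set_decode_less by blast
  have "decpred (\<lambda>z. table (set_decode (pfst z)) (set_decode (psnd z)))"
    unfolding table_def justified_def Let_def bd ball by (intro rec_intros)
  from decpred_lift2[OF this assms] show ?thesis .
qed

subsection \<open>The construction\<close>

lemma recfn_lift3:
  assumes "recfn (\<lambda>z. F (pfst z) (pfst (psnd z)) (psnd (psnd z)))" "recfn f" "recfn g" "recfn h"
  shows "recfn (\<lambda>z. F (f z) (g z) (h z))"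
  using recfn_compose[OF assms(1) recfn_pe[OF assms(2) recfn_pe[OF assms(3,4)]]] by simp

lemma recfn_lift4:
  assumes "recfn (\<lambda>z. F (pfst z) (pfst (psnd z)) (pfst (psnd (psnd z))) (psnd (psnd (psnd z))))"
    "recfn f" "recfn g" "recfn h" "recfn i"
  shows "recfn (\<lambda>z. F (f z) (g z) (h z) (i z))"
  using recfn_lift3[of "\<lambda>a b c. F a b (pfst c) (psnd c)", OF assms(1-3) recfn_pe[OF assms(4,5)]]
  by simp

lemma recfn_lift5:
  assumes "recfn (\<lambda>z. F (pfst z) (pfst (psnd z)) (pfst (psnd (psnd z)))
      (pfst (psnd (psnd (psnd z)))) (psnd (psnd (psnd (psnd z)))))"
    "recfn f" "recfn g" "recfn h" "recfn i" "recfn j"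
  shows "recfn (\<lambda>z. F (f z) (g z) (h z) (i z) (j z))"
  using recfn_lift4[of "\<lambda>a b c d. F a b c (pfst d) (psnd d)", OF assms(1-4) recfn_pe[OF assms(5,6)]]
  by simp

lemmas decpred_lift3 = recfn_lift3[of "\<lambda>a b c. of_bool (P a b c)" for P, folded decpred_def]
  and decpred_lift4 = recfn_lift4[of "\<lambda>a b c d. of_bool (P a b c d)" for P, folded decpred_def]
  and decpred_lift5 = recfn_lift5[of "\<lambda>a b c d e. of_bool (P a b c d e)" for P, folded decpred_def]

lemma ball_set_decode: "(\<forall>z\<in>set_decode T. P z) \<longleftrightarrow> (\<forall>z<T. z \<in> set_decode T \<longrightarrow> P z)"
  and bex_set_decode: "(\<exists>z\<in>set_decode T. P z) \<longleftrightarrow> (\<exists>z<T. z \<in> set_decode T \<and> P z)"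
  using set_decode_less by blast+

text \<open>
  A witness is a number \<open>w\<close> coding \<open>(j, X, T, x)\<close>, where the table \<open>T\<close> shows that the functional
  returns 1 at \<open>x\<close> with oracle \<open>X\<close>, and \<open>X\<close> is homogeneous with color \<open>j\<close>.  A state codes
  \<open>(E, b, m)\<close>, where \<open>E\<close> is the union of the finite homogeneous sets built in the first \<open>m\<close> rounds,
  all below \<open>b\<close>; the set of color \<open>j\<close> is the part of \<open>E\<close> to which the partition in question gives
  color \<open>j\<close>.  The parameters \<open>C\<close>, \<open>G\<close> and \<open>e\<close> stand for the coloring of pairs, the limit colors and
  the coloring under construction, or for their approximations at a stage.
\<close>

abbreviation wcol :: "nat \<Rightarrow> nat" where "wcol w \<equiv> pfst w"
abbreviation wset :: "nat \<Rightarrow> nat set" where "wset w \<equiv> set_decode (pfst (psnd w))"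
abbreviation wtab :: "nat \<Rightarrow> nat set" where "wtab w \<equiv> set_decode (pfst (psnd (psnd w)))"
abbreviation wval :: "nat \<Rightarrow> nat" where "wval w \<equiv> psnd (psnd (psnd w))"
abbreviation sset :: "nat \<Rightarrow> nat set" where "sset \<sigma> \<equiv> set_decode (pfst \<sigma>)"
abbreviation sbd :: "nat \<Rightarrow> nat" where "sbd \<sigma> \<equiv> pfst (psnd \<sigma>)"
abbreviation srnd :: "nat \<Rightarrow> nat" where "srnd \<sigma> \<equiv> psnd (psnd \<sigma>)"

text \<open>The digit \<open>i\<close> in base \<open>k + 1\<close>; it recovers the component
  \<open>e\<^sub>i\<close> from the coded product color.\<close>

definition digit :: "nat \<Rightarrow> nat \<Rightarrow> nat \<Rightarrow> nat" where
  "digit k i c = (c div Suc k ^ i) mod Suc k"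

definition witness ::
  "(nat \<Rightarrow> nat \<Rightarrow> nat \<Rightarrow> bool) \<Rightarrow> (nat \<Rightarrow> nat) \<Rightarrow> nat \<Rightarrow> nat \<Rightarrow> nat \<Rightarrow> nat \<Rightarrow> nat \<Rightarrow> bool" where
  "witness C e k p i \<sigma> w \<longleftrightarrow>
     wcol w < k \<and> (\<forall>z\<in>wset w. \<forall>y\<in>wset w. y < z \<longrightarrow> C y z (wcol w)) \<and>
     table (wset w) (wtab w) \<and> pe p (pe (wval w) 1) \<in> wtab w \<and>
     sbd \<sigma> \<le> wval w \<and> digit k i (e (wval w)) = srnd \<sigma> mod Suc k"

text \<open>The oracle of the witness is an end extension, inside its color class, of the set built
  so far. The last clause demands a new point, so that a set extended infinitely often becomes
  infinite.\<close>

definition fits :: "(nat \<Rightarrow> nat \<Rightarrow> bool) \<Rightarrow> nat \<Rightarrow> nat \<Rightarrow> bool" where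
  "fits R \<sigma> w \<longleftrightarrow>
     (\<forall>y<sbd \<sigma>. y \<in> wset w \<longleftrightarrow> y \<in> sset \<sigma> \<and> R y (wcol w)) \<and>
     (\<forall>y\<in>wset w. R y (wcol w)) \<and> (\<exists>y\<in>wset w. sbd \<sigma> \<le> y)"

text \<open>
  \<open>N i\<close> is the partition \<open>P\<^sub>i\<close>, as a relation between points and colors.  It need not be
  single-valued: nonempty values that are disjoint for different \<open>i\<close> suffice.
\<close>

definition barren ::
  "(nat \<Rightarrow> nat \<Rightarrow> nat \<Rightarrow> bool) \<Rightarrow> (nat \<Rightarrow> nat \<Rightarrow> bool) \<Rightarrow> (nat \<Rightarrow> nat) \<Rightarrow> nat \<Rightarrow> nat \<Rightarrow>
    nat \<Rightarrow> nat \<Rightarrow> (nat \<Rightarrow> nat \<Rightarrow> nat \<Rightarrow> bool) \<Rightarrow> nat \<Rightarrow> bool" where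
  "barren C G e k p i \<sigma> N t \<longleftrightarrow>
     (\<forall>x<t. \<exists>v<k. N i x v) \<and>
     (\<forall>x<t. x < sbd \<sigma> \<longrightarrow> (\<forall>v<k. N i x v \<longleftrightarrow> G x v)) \<and>
     (\<forall>x<t. sbd \<sigma> \<le> x \<longrightarrow> (\<forall>h<i. \<forall>v<k. \<not> (N i x v \<and> N h x v))) \<and>
     (\<forall>w<t. \<not> (witness C e k p i \<sigma> w \<and> fits (N i) \<sigma> w))"

text \<open>One \<open>N\<close> serves all levels at once, because each level is compared with the
  lower ones. A round ends at the first \<open>t\<close> for which no such \<open>N\<close>
  exists.\<close>

definition barren_upto ::
  "(nat \<Rightarrow> nat \<Rightarrow> nat \<Rightarrow> bool) \<Rightarrow> (nat \<Rightarrow> nat \<Rightarrow> bool) \<Rightarrow> (nat \<Rightarrow> nat) \<Rightarrow> nat \<Rightarrow> nat \<Rightarrow>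
    nat \<Rightarrow> (nat \<Rightarrow> nat) \<Rightarrow> nat \<Rightarrow> bool" where
  "barren_upto C G e k p l S t \<longleftrightarrow> (\<exists>N. \<forall>i<Suc l. barren C G e k p i (S i) N t)"

text \<open>
  When a round ends although no witness fits the true limit colors, it is passed with \<open>E\<close> unchanged.
  This is harmless, because from some round on the true partition is among those considered.
\<close>

definition enlarge ::
  "(nat \<Rightarrow> nat \<Rightarrow> nat \<Rightarrow> bool) \<Rightarrow> (nat \<Rightarrow> nat \<Rightarrow> bool) \<Rightarrow> (nat \<Rightarrow> nat) \<Rightarrow> nat \<Rightarrow> nat \<Rightarrow>
    nat \<Rightarrow> nat \<Rightarrow> nat \<Rightarrow> nat" where
  "enlarge C G e k p l \<sigma> t =
     (let w = LEAST w. t \<le> w \<or> (witness C e k p l \<sigma> w \<and> fits G \<sigma> w) in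
      pe (set_encode {y. y < t \<and> (y \<in> sset \<sigma> \<and> y < sbd \<sigma> \<or> w < t \<and> y \<in> wset w)})
         (pe t (Suc (srnd \<sigma>))))"

text \<open>The search may not go beyond \<open>u\<close>, the range of known data. If it does, the
  round counts as unfinished and the state is kept.\<close>

definition step ::
  "nat \<Rightarrow> (nat \<Rightarrow> nat \<Rightarrow> nat \<Rightarrow> bool) \<Rightarrow> (nat \<Rightarrow> nat \<Rightarrow> bool) \<Rightarrow> (nat \<Rightarrow> nat) \<Rightarrow> nat \<Rightarrow> nat \<Rightarrow>
    nat \<Rightarrow> (nat \<Rightarrow> nat) \<Rightarrow> nat \<Rightarrow> nat" where
  "step u C G e k p l S \<sigma> =
     (let t = LEAST t. sbd \<sigma> < t \<and>
          (u < t \<or> \<not> barren_upto C G e k p l (\<lambda>i. if i = l then \<sigma> else S i) t) in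
      if u < t then \<sigma> else enlarge C G e k p l \<sigma> t)"

text \<open>Steps in an unfinished round change nothing, so the number of iterations only has to
  tend to infinity with the stage.\<close>

definition path ::
  "nat \<Rightarrow> (nat \<Rightarrow> nat \<Rightarrow> nat \<Rightarrow> bool) \<Rightarrow> (nat \<Rightarrow> nat \<Rightarrow> bool) \<Rightarrow> (nat \<Rightarrow> nat) \<Rightarrow> nat \<Rightarrow> nat \<Rightarrow>
    nat \<Rightarrow> (nat \<Rightarrow> nat) \<Rightarrow> nat" where
  "path u C G e k p l S = (step u C G e k p l S ^^ u) (pe 0 (pe 0 0))"

text \<open>Course-of-values recursion over levels, since level \<open>l\<close> refers to the
  states of all lower ones; \<open>level_eq\<close> is the resulting equation.\<close>

definition level ::
  "nat \<Rightarrow> (nat \<Rightarrow> nat \<Rightarrow> nat \<Rightarrow> bool) \<Rightarrow> (nat \<Rightarrow> nat \<Rightarrow> bool) \<Rightarrow> (nat \<Rightarrow> nat) \<Rightarrow> nat \<Rightarrow> nat \<Rightarrow>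
    nat \<Rightarrow> nat" where
  "level u C G e k p l =
     (let \<Gamma> = \<lambda>l r. path u C G e k p l (\<lambda>i. look r (l - Suc i)) in \<Gamma> l (history \<Gamma> l))"

definition color ::
  "nat \<Rightarrow> (nat \<Rightarrow> nat \<Rightarrow> nat \<Rightarrow> bool) \<Rightarrow> (nat \<Rightarrow> nat \<Rightarrow> bool) \<Rightarrow> (nat \<Rightarrow> nat) \<Rightarrow> nat \<Rightarrow> nat \<Rightarrow> nat" where
  "color u C G e k p = (\<Sum>l<k. (srnd (level u C G e k p l) mod Suc k) * Suc k ^ l)"

text \<open>All data of a witness are bounded by its code. A search for witnesses below
  \<open>t\<close> therefore consults pairs, and values of \<open>e\<close>, only below
  \<open>t\<close>.\<close>

lemma witness_code_bounds:
  "z \<in> wset w \<Longrightarrow> z < w" "z \<in> wtab w \<Longrightarrow> z < w" "wval w \<le> w"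
proof -
  have *: "pfst a \<le> a" "psnd a \<le> a" for a
    using le_prod_encode_1[of "pfst a" "psnd a"] le_prod_encode_2[of "psnd a" "pfst a"] by auto
  show "z \<in> wset w \<Longrightarrow> z < w"
    using set_decode_less *(2)[of w] *(1)[of "psnd w"] by fastforce
  show "z \<in> wtab w \<Longrightarrow> z < w"
    using set_decode_less *(2)[of w] *(2)[of "psnd w"] *(1)[of "psnd (psnd w)"] by fastforce
  show "wval w \<le> w"
    using *(2)[of w] *(2)[of "psnd w"] *(2)[of "psnd (psnd w)"] by linarith
qed

lemma witness_cong:
  assumes "\<And>y z v. y < z \<Longrightarrow> z < w \<Longrightarrow> v < k \<Longrightarrow> C y z v \<longleftrightarrow> C' y z v" "e (wval w) = e' (wval w)"
  shows "witness C e k p i \<sigma> w \<longleftrightarrow> witness C' e' k p i \<sigma> w"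
proof -
  have "C y z (wcol w) \<longleftrightarrow> C' y z (wcol w)" if "wcol w < k" "y < z" "z \<in> wset w" for y z
    using assms(1) that witness_code_bounds(1) by blast
  then show ?thesis unfolding witness_def assms(2) by blast
qed

lemma fits_cong:
  assumes "\<And>x. x < sbd \<sigma> \<or> x < w \<Longrightarrow> R x (wcol w) \<longleftrightarrow> R' x (wcol w)"
  shows "fits R \<sigma> w \<longleftrightarrow> fits R' \<sigma> w"
  unfolding fits_def using assms witness_code_bounds(1) by blast

lemma barren_cong:
  assumes N: "\<And>h x v. h \<le> i \<Longrightarrow> x < t \<Longrightarrow> v < k \<Longrightarrow> N h x v \<longleftrightarrow> N' h x v"
    and C: "\<And>y z v. y < z \<Longrightarrow> z < t \<Longrightarrow> v < k \<Longrightarrow> C y z v \<longleftrightarrow> C' y z v"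
    and G: "\<And>x v. x < t \<Longrightarrow> x < sbd \<sigma> \<Longrightarrow> v < k \<Longrightarrow> G x v \<longleftrightarrow> G' x v"
    and e: "\<And>x. x < t \<Longrightarrow> e x = e' x"
  shows "barren C G e k p i \<sigma> N t \<longleftrightarrow> barren C' G' e' k p i \<sigma> N' t"
proof -
  have w: "witness C e k p i \<sigma> w \<and> fits (N i) \<sigma> w \<longleftrightarrow> witness C' e' k p i \<sigma> w \<and> fits (N' i) \<sigma> w"
    if "w < t" for w
  proof -
    have 1: "witness C e k p i \<sigma> w \<longleftrightarrow> witness C' e' k p i \<sigma> w"
      by (rule witness_cong) (use C e that witness_code_bounds(3)[of w] in auto)
    have 2: "fits (N i) \<sigma> w \<longleftrightarrow> fits (N' i) \<sigma> w" if "witness C' e' k p i \<sigma> w"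
    proof (rule fits_cong)
      \<comment> \<open>\<open>fits\<close> inspects all points below \<open>sbd \<sigma>\<close>;
        for a witness this bound is at most \<open>wval w\<close> and so below
        \<open>t\<close>.\<close>
      have "sbd \<sigma> < t" "wcol w < k"
        using that \<open>w < t\<close> witness_code_bounds(3)[of w] by (auto simp: witness_def)
      then show "N i x (wcol w) \<longleftrightarrow> N' i x (wcol w)" if "x < sbd \<sigma> \<or> x < w" for x
        using N that \<open>w < t\<close> by auto
    qed
    show ?thesis using 1 2 by blast
  qed
  have "(\<forall>x<t. \<exists>v<k. N i x v) \<longleftrightarrow> (\<forall>x<t. \<exists>v<k. N' i x v)"
    using N by blast
  moreover have "(\<forall>x<t. x < sbd \<sigma> \<longrightarrow> (\<forall>v<k. N i x v \<longleftrightarrow> G x v)) \<longleftrightarrow>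
      (\<forall>x<t. x < sbd \<sigma> \<longrightarrow> (\<forall>v<k. N' i x v \<longleftrightarrow> G' x v))"
    using N G by blast
  moreover have "(\<forall>x<t. sbd \<sigma> \<le> x \<longrightarrow> (\<forall>h<i. \<forall>v<k. \<not> (N i x v \<and> N h x v))) \<longleftrightarrow>
      (\<forall>x<t. sbd \<sigma> \<le> x \<longrightarrow> (\<forall>h<i. \<forall>v<k. \<not> (N' i x v \<and> N' h x v)))"
  proof -
    have "N i x v \<and> N h x v \<longleftrightarrow> N' i x v \<and> N' h x v" if "x < t" "h < i" "v < k" for x h v
      using N[of i x v] N[of h x v] that by auto
    then show ?thesis by blast
  qed
  moreover have "(\<forall>w<t. \<not> (witness C e k p i \<sigma> w \<and> fits (N i) \<sigma> w)) \<longleftrightarrow>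
      (\<forall>w<t. \<not> (witness C' e' k p i \<sigma> w \<and> fits (N' i) \<sigma> w))"
    using w by blast
  ultimately show ?thesis unfolding barren_def by (simp only:)
qed

text \<open>
  Stage \<open>s\<close> is coded by \<open>\<theta> = ((k, a, p), s, H)\<close>, where \<open>H\<close> lists the values of \<open>e\<close> below \<open>s\<close>.  By this
  stage the colors of all pairs below or at \<open>known \<theta>\<close> have been computed, and the color of
  \<open>{y, known \<theta>}\<close> serves as the guess at the limit color of \<open>y\<close>.
\<close>

abbreviation th_k :: "nat \<Rightarrow> nat" where "th_k \<theta> \<equiv> pfst (pfst \<theta>)"
abbreviation th_a :: "nat \<Rightarrow> nat" where "th_a \<theta> \<equiv> pfst (psnd (pfst \<theta>))"
abbreviation th_p :: "nat \<Rightarrow> nat" where "th_p \<theta> \<equiv> psnd (psnd (pfst \<theta>))"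
abbreviation th_s :: "nat \<Rightarrow> nat" where "th_s \<theta> \<equiv> pfst (psnd \<theta>)"
abbreviation th_H :: "nat \<Rightarrow> nat" where "th_H \<theta> \<equiv> psnd (psnd \<theta>)"

definition col_at :: "nat \<Rightarrow> nat \<Rightarrow> nat \<Rightarrow> nat \<Rightarrow> bool" where
  "col_at \<theta> y z v \<longleftrightarrow>
     (\<exists>T<th_s \<theta>. table (set_decode 0) (set_decode T) \<and> pe (th_a \<theta>) (pe (pe y z) v) \<in> set_decode T)"

text \<open>Testing row \<open>u + 1\<close> makes the least failure the last complete row; row 0
  contains no pairs. The cap \<open>th_s \<theta>\<close> makes the search total and restricts the
  construction to values of \<open>e\<close> already defined.\<close>

definition known :: "nat \<Rightarrow> nat" where
  "known \<theta> = (LEAST u. th_s \<theta> \<le> u \<or> \<not> (\<forall>x<Suc u. \<exists>v<th_k \<theta>. col_at \<theta> x (Suc u) v))"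

definition guess :: "nat \<Rightarrow> nat \<Rightarrow> nat \<Rightarrow> bool" where
  "guess \<theta> y v \<longleftrightarrow> col_at \<theta> y (known \<theta>) v"

definition past :: "nat \<Rightarrow> nat \<Rightarrow> nat" where
  "past \<theta> x = look (th_H \<theta>) (th_s \<theta> - Suc x)"

definition next_color :: "nat \<Rightarrow> nat \<Rightarrow> nat \<Rightarrow> nat" where
  "next_color q s H =
    (let \<theta> = pe q (pe s H) in color (known \<theta>) (col_at \<theta>) (guess \<theta>) (past \<theta>) (th_k \<theta>) (th_p \<theta>))"

definition coloring :: "nat \<Rightarrow> nat \<Rightarrow> nat" where
  "coloring q s = next_color q s (history (next_color q) s)"

section \<open>Computability of the stages\<close>

lemma decpred_col_at [rec_intros]:
  assumes "recfn f" "recfn g" "recfn h" "recfn i"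
  shows "decpred (\<lambda>z. col_at (f z) (g z) (h z) (i z))"
  by (rule decpred_lift4[OF _ assms], unfold col_at_def, intro rec_intros)

lemma recfn_known [rec_intros]:
  assumes "recfn f" shows "recfn (\<lambda>z. known (f z))"
  by (rule recfn_compose[OF _ assms], unfold known_def, intro recfn_Least rec_intros, blast)

lemma decpred_guess [rec_intros]:
  assumes "recfn f" "recfn g" "recfn h" shows "decpred (\<lambda>z. guess (f z) (g z) (h z))"
  unfolding guess_def by (intro rec_intros assms)

lemma recfn_past [rec_intros]:
  assumes "recfn f" "recfn g" shows "recfn (\<lambda>z. past (f z) (g z))"
  unfolding past_def by (intro rec_intros assms)

lemma recfn_digit [rec_intros]:
  assumes "recfn f" "recfn g" "recfn h" shows "recfn (\<lambda>z. digit (f z) (g z) (h z))"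
  unfolding digit_def by (intro rec_intros assms)

abbreviation "witness_at \<theta> \<equiv> witness (col_at \<theta>) (past \<theta>) (th_k \<theta>) (th_p \<theta>)"
abbreviation "barren_at \<theta> \<equiv> barren (col_at \<theta>) (guess \<theta>) (past \<theta>) (th_k \<theta>) (th_p \<theta>)"
abbreviation "barren_upto_at \<theta> \<equiv> barren_upto (col_at \<theta>) (guess \<theta>) (past \<theta>) (th_k \<theta>) (th_p \<theta>)"
abbreviation "enlarge_at \<theta> \<equiv> enlarge (col_at \<theta>) (guess \<theta>) (past \<theta>) (th_k \<theta>) (th_p \<theta>)"
abbreviation "step_at \<theta> \<equiv> step (known \<theta>) (col_at \<theta>) (guess \<theta>) (past \<theta>) (th_k \<theta>) (th_p \<theta>)"
abbreviation "path_at \<theta> \<equiv> path (known \<theta>) (col_at \<theta>) (guess \<theta>) (past \<theta>) (th_k \<theta>) (th_p \<theta>)"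
abbreviation "level_at \<theta> \<equiv> level (known \<theta>) (col_at \<theta>) (guess \<theta>) (past \<theta>) (th_k \<theta>) (th_p \<theta>)"
abbreviation coded :: "nat \<Rightarrow> nat \<Rightarrow> nat \<Rightarrow> nat \<Rightarrow> bool" where
  "coded N i x v \<equiv> pe (pe i x) v \<in> set_decode N"

lemma decpred_witness_at [rec_intros]:
  assumes "recfn f" "recfn g" "recfn h" "recfn i"
  shows "decpred (\<lambda>z. witness_at (f z) (g z) (h z) (i z))"
  by (rule decpred_lift4[OF _ assms], unfold witness_def ball_set_decode, intro rec_intros)

lemma decpred_fits_guess [rec_intros]:
  assumes "recfn f" "recfn g" "recfn h" shows "decpred (\<lambda>z. fits (guess (f z)) (g z) (h z))"
  by (rule decpred_lift3[OF _ assms], unfold fits_def ball_set_decode bex_set_decode, intro rec_intros)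

lemma decpred_fits_coded [rec_intros]:
  assumes "recfn f" "recfn g" "recfn h" "recfn i"
  shows "decpred (\<lambda>z. fits (coded (f z) (g z)) (h z) (i z))"
  by (rule decpred_lift4[OF _ assms], unfold fits_def ball_set_decode bex_set_decode, intro rec_intros)

lemma decpred_barren_at [rec_intros]:
  assumes "recfn f" "recfn g" "recfn h" "recfn i" "recfn j"
  shows "decpred (\<lambda>z. barren_at (f z) (g z) (h z) (coded (i z)) (j z))"
  by (rule decpred_lift5[OF _ assms], unfold barren_def, intro rec_intros)

lemma pe_strict_mono:
  assumes "a \<le> a'" "b < b'" shows "pe a b < pe a' b'"
proof -
  have tri: "triangle m \<le> triangle n" if "m \<le> n" for m n
    using that by (induction rule: dec_induct) auto
  have "pe a b < triangle (Suc (a + b))" by (simp add: prod_encode_def)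
  also have "\<dots> \<le> pe a' b'" using tri[of "Suc (a + b)" "a' + b'"] assms by (simp add: prod_encode_def)
  finally show ?thesis .
qed

lemma set_encode_less:
  assumes "A \<subseteq> {..<n}" shows "set_encode A < 2 ^ n"
proof -
  have "set_encode A \<le> (\<Sum>y<n. 2 ^ y)"
    unfolding set_encode_def by (rule sum_mono2) (use assms in auto)
  also have "\<dots> < (2::nat) ^ n" by (induction n) auto
  finally show ?thesis .
qed

text \<open>By \<open>barren_cong\<close> only the finitely many values of \<open>N\<close> at
  levels up to \<open>l\<close>, points below \<open>t\<close> and colors below \<open>k\<close>
  matter, so the quantifier over relations becomes a bounded one over codes of finite sets.\<close>

lemma barren_upto_coded:
  "barren_upto C G e k p l S t \<longleftrightarrow>
    (\<exists>N < 2 ^ pe (pe l t) k. \<forall>i<Suc l. barren C G e k p i (S i) (coded N) t)"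
proof
  assume "barren_upto C G e k p l S t"
  then obtain N where N: "\<And>i. i < Suc l \<Longrightarrow> barren C G e k p i (S i) N t"
    unfolding barren_upto_def by blast
  define A where "A = {z. z < pe (pe l t) k \<and> N (pfst (pfst z)) (psnd (pfst z)) (psnd z)}"
  have fin: "finite A" by (simp add: A_def)
  have "coded (set_encode A) i x v \<longleftrightarrow> N i x v" if "i < Suc l" "x < t" "v < k" for i x v
  proof -
    have "pe (pe i x) v < pe (pe l t) k"
      by (rule pe_strict_mono) (use that pe_strict_mono[of i l x t] in auto)
    then show ?thesis using fin by (simp add: A_def)
  qed
  then have "barren C G e k p i (S i) (coded (set_encode A)) t" if "i < Suc l" for i
    using N[OF that] that by (subst barren_cong[where N' = N and C' = C and G' = G and e' = e]) auto
  moreover have "set_encode A < 2 ^ pe (pe l t) k"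
    by (rule set_encode_less) (auto simp: A_def)
  ultimately show "\<exists>N < 2 ^ pe (pe l t) k. \<forall>i<Suc l. barren C G e k p i (S i) (coded N) t"
    by blast
qed (auto simp: barren_upto_def)

lemma decpred_barren_upto_at [rec_intros]:
  assumes "recfn f" "recfn g" "recfn h" "recfn i" "recfn j"
  shows "decpred (\<lambda>z. barren_upto_at (f z) (g z)
    (\<lambda>n. if n = g z then h z else look (i z) (g z - Suc n)) (j z))"
  by (rule decpred_lift5[OF _ assms], unfold barren_upto_coded, intro rec_intros)

lemma recfn_enlarge_at [rec_intros]:
  assumes "recfn f" "recfn g" "recfn h" "recfn i"
  shows "recfn (\<lambda>z. enlarge_at (f z) (g z) (h z) (i z))"
  by (rule recfn_lift4[OF _ assms], unfold enlarge_def Let_def,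
    intro rec_intros recfn_Least, auto)

lemma recfn_step_at [rec_intros]:
  assumes "recfn f" "recfn g" "recfn h" "recfn i"
  shows "recfn (\<lambda>z. step_at (f z) (g z) (\<lambda>n. look (h z) (g z - Suc n)) (i z))"
proof -
  have ex: "\<exists>t. b < t \<and> (u < t \<or> P t)" for b u :: nat and P
    by (rule exI[of _ "Suc (b + u)"]) simp
  show ?thesis
    by (rule recfn_lift4[OF _ assms], unfold step_def Let_def,
      intro rec_intros recfn_Least ex)
qed

lemma recfn_path_at [rec_intros]:
  assumes "recfn f" "recfn g" "recfn h"
  shows "recfn (\<lambda>z. path_at (f z) (g z) (\<lambda>n. look (h z) (g z - Suc n)))"
proof -
  have *: "(F ^^ n) a = rec_nat a (\<lambda>_. F) n" for F :: "nat \<Rightarrow> nat" and n a by (induction n) auto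
  show ?thesis by (rule recfn_lift3[OF _ assms], unfold path_def *, intro rec_intros)
qed

lemma recfn_level_at [rec_intros]:
  assumes "recfn f" "recfn g" shows "recfn (\<lambda>z. level_at (f z) (g z))"
  by (rule recfn_lift2[OF _ assms], unfold level_def Let_def, intro rec_intros)

text \<open>Every search in the construction has a default, so the coloring is total even where
  \<open>d\<close> is partial. Taking \<open>q\<close> as an argument prepares the uniformity in
  \<open>k\<close>, \<open>a\<close> and \<open>p\<close>.\<close>

lemma recfn_coloring: "recfn (\<lambda>z. coloring (pfst z) (psnd z))"
  unfolding coloring_def next_color_def color_def Let_def by (intro rec_intros)

section \<open>Digits in base k + 1 and the bound #(k)\<close>

lemma digit_sum_less: "(\<Sum>l<n. (f l mod Suc k) * Suc k ^ l) < Suc k ^ n"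
proof (induction n)
  case (Suc n)
  have "(f n mod Suc k) * Suc k ^ n \<le> k * Suc k ^ n"
    by (rule mult_right_mono) (use mod_less_divisor[of "Suc k" "f n"] in linarith, simp)
  from add_less_le_mono[OF Suc this] show ?case by simp
qed simp

lemma digit_sum:
  assumes "i < n"
  shows "digit k i (\<Sum>l<n. (f l mod Suc k) * Suc k ^ l) = f i mod Suc k"
  using assms
proof (induction n)
  case (Suc n)
  let ?S = "\<Sum>l<n. (f l mod Suc k) * Suc k ^ l"
  show ?case
  proof (cases "i = n")
    case True
    then show ?thesis using digit_sum_less[of f k n] by (simp add: digit_def)
  next
    case False
    with Suc have IH: "digit k i ?S = f i mod Suc k" and "i < n" by auto
    obtain j where n: "n = Suc (i + j)" using \<open>i < n\<close> less_imp_Suc_add by blast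
    define q where "q = (f n mod Suc k) * Suc k ^ j"
    have "(f n mod Suc k) * Suc k ^ n = Suc k ^ i * (Suc k * q)"
      by (simp add: n q_def power_add algebra_simps)
    then have "(\<Sum>l<Suc n. (f l mod Suc k) * Suc k ^ l) div Suc k ^ i = ?S div Suc k ^ i + Suc k * q"
      by (simp only: sum.lessThan_Suc) (simp del: mult_Suc)
    then show ?thesis using IH by (simp only: digit_def mod_mult_self2)
  qed
qed simp

text \<open>For positive \<open>k\<close>, \<open>k + 2\<close> is at most \<open>(k + 1)^2\<close>
  and hence at most \<open>(k + 1)^(k + 1)\<close>. Raising this to the power \<open>k\<close> and
  exchanging exponents brings in the induction hypothesis.\<close>

lemma power_le_sharp: "Suc k ^ k \<le> sharp k"
proof (induction k)
  case (Suc k)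
  have "Suc (Suc k) ^ k \<le> sharp k ^ Suc k"
  proof (cases "k = 0")
    case False
    have "Suc (Suc k) \<le> Suc k * Suc k" using False by (cases k) auto
    also have "\<dots> \<le> Suc k * Suc k ^ k" using False by (intro mult_left_mono self_le_power) auto
    also have "\<dots> = Suc k ^ Suc k" by simp
    finally have "Suc (Suc k) ^ k \<le> (Suc k ^ Suc k) ^ k" by (rule power_mono) simp
    also have "\<dots> = (Suc k ^ k) ^ Suc k" by (simp only: mult.commute flip: power_mult)
    also have "\<dots> \<le> sharp k ^ Suc k" using Suc.IH by (rule power_mono) simp
    finally show ?thesis .
  qed simp
  then have "Suc (Suc k) * Suc (Suc k) ^ k \<le> Suc (Suc k) * sharp k ^ Suc k"
    by (rule mult_left_mono) simp
  then show ?case by simp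
qed simp

section \<open>Recursion over levels and compactness\<close>

lemma barren_mono: "barren C G e k p i \<sigma> N t \<Longrightarrow> t' \<le> t \<Longrightarrow> barren C G e k p i \<sigma> N t'"
  unfolding barren_def by (meson order_less_le_trans)

lemma barren_upto_cong_levels:
  assumes "\<And>i. i < Suc l \<Longrightarrow> S i = S' i"
  shows "barren_upto C G e k p l S t \<longleftrightarrow> barren_upto C G e k p l S' t"
  unfolding barren_upto_def using assms by simp

lemma path_cong:
  assumes "\<And>i. i < l \<Longrightarrow> S i = S' i"
  shows "path u C G e k p l S = path u C G e k p l S'"
proof -
  have "barren_upto C G e k p l (\<lambda>i. if i = l then \<sigma> else S i) t \<longleftrightarrow>
      barren_upto C G e k p l (\<lambda>i. if i = l then \<sigma> else S' i) t" for \<sigma> t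
    by (rule barren_upto_cong_levels) (use assms in auto)
  then have "step u C G e k p l S = step u C G e k p l S'"
    unfolding step_def by (intro ext) simp
  then show ?thesis by (simp add: path_def)
qed

lemma level_eq: "level u C G e k p l = path u C G e k p l (level u C G e k p)"
proof -
  define \<Gamma> where "\<Gamma> = (\<lambda>l r. path u C G e k p l (\<lambda>i. look r (l - Suc i)))"
  have lev: "level u C G e k p l = \<Gamma> l (history \<Gamma> l)" for l
    by (simp add: level_def \<Gamma>_def Let_def)
  have "\<Gamma> l (history \<Gamma> l) = path u C G e k p l (level u C G e k p)"
    by (subst \<Gamma>_def, rule path_cong) (simp add: look_history lev)
  then show ?thesis by (simp add: lev)
qed

text \<open>Compactness of Cantor space: the nested infinite sets \<open>I n\<close> consist of
  indices on which the first \<open>n\<close> bits are constant.\<close>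

lemma bool_sequence_compact:
  fixes f :: "nat \<Rightarrow> nat \<Rightarrow> bool"
  obtains g where "\<And>n m. \<exists>t\<ge>m. \<forall>z<n. f t z \<longleftrightarrow> g z"
proof -
  define I where "I = rec_nat UNIV (\<lambda>n J. if infinite {t\<in>J. f t n} then {t\<in>J. f t n} else {t\<in>J. \<not> f t n})"
  define g where "g n \<longleftrightarrow> infinite {t\<in>I n. f t n}" for n
  have I_Suc: "I (Suc n) = {t\<in>I n. f t n \<longleftrightarrow> g n}" for n
    by (auto simp: I_def g_def)
  have inf: "infinite (I n)" for n
  proof (induction n)
    case (Suc n)
    have "I n = {t\<in>I n. f t n} \<union> {t\<in>I n. \<not> f t n}" by blast
    with Suc have "infinite {t\<in>I n. f t n} \<or> infinite {t\<in>I n. \<not> f t n}"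
      by (metis finite_Un)
    then show ?case unfolding I_Suc by (cases "g n") (auto simp: g_def)
  qed (simp add: I_def)
  have agree: "t \<in> I n \<Longrightarrow> z < n \<Longrightarrow> f t z \<longleftrightarrow> g z" for t n z
    by (induction n) (auto simp: I_Suc less_Suc_eq)
  show thesis
  proof
    fix n m
    obtain t where "t \<in> I n" "m \<le> t" using inf[of n] by (meson infinite_nat_iff_unbounded_le)
    then show "\<exists>t\<ge>m. \<forall>z<n. f t z \<longleftrightarrow> g z" using agree by blast
  qed
qed

text \<open>Relations for ever larger \<open>t\<close> are read as bit sequences over coded triples.
  A cluster point agrees on each finite part with relations for arbitrarily large \<open>t\<close>,
  and barrenness at a given \<open>t\<close> depends on a finite part only.\<close>

lemma barren_upto_compact:
  assumes "\<And>t. b < t \<Longrightarrow> barren_upto C G e k p l S t"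
  shows "\<exists>N. \<forall>t. \<forall>i<Suc l. barren C G e k p i (S i) N t"
proof -
  have "\<exists>N. \<forall>i<Suc l. barren C G e k p i (S i) N (b + Suc t)" for t
    using assms[of "b + Suc t"] unfolding barren_upto_def by simp
  then obtain N where N: "\<And>t i. i < Suc l \<Longrightarrow> barren C G e k p i (S i) (N t) (b + Suc t)" by metis
  obtain g where g: "\<And>n m. \<exists>t\<ge>m. \<forall>z<n. N t (pfst (pfst z)) (psnd (pfst z)) (psnd z) \<longleftrightarrow> g z"
    using bool_sequence_compact[of "\<lambda>t z. N t (pfst (pfst z)) (psnd (pfst z)) (psnd z)"] by blast
  have "barren C G e k p i (S i) (\<lambda>i x v. g (pe (pe i x) v)) t" if "i < Suc l" for i t
  proof -
    obtain r where "t \<le> r" and r: "\<forall>z<pe (pe l t) k. N r (pfst (pfst z)) (psnd (pfst z)) (psnd z) \<longleftrightarrow> g z"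
      using g by blast
    have "barren C G e k p i (S i) (N r) t"
      by (rule barren_mono[OF N[OF that]]) (use \<open>t \<le> r\<close> in simp)
    moreover have "N r h x v \<longleftrightarrow> g (pe (pe h x) v)" if "h \<le> i" "x < t" "v < k" for h x v
    proof -
      have "pe (pe h x) v < pe (pe l t) k"
        by (rule pe_strict_mono) (use that \<open>i < Suc l\<close> pe_strict_mono[of h l x t] in auto)
      with r show ?thesis by fastforce
    qed
    ultimately show ?thesis
      by (subst barren_cong[where N' = "N r" and C' = C and G' = G and e' = e]) auto
  qed
  then show ?thesis by blast
qed

subsection \<open>Limit behaviour of the construction\<close>

text \<open>The setting for a proof by contradiction: \<open>nowin\<close> denies that any infinite
  homogeneous set is as desired.\<close>

locale no_win =
  fixes k a p :: nat and d :: "nat set \<rightharpoonup> nat"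
  assumes pc: "partial_coloring k d" and ci: "coloring_index a d"
    and tot: "total_coloring d" and stab: "stable_coloring d"
    and nowin: "\<And>H. infinite H \<Longrightarrow> homogeneous d H \<Longrightarrow>
      \<exists>A i. infinite A \<and> finite {x\<in>A. coloring (pe k (pe a p)) x \<noteq> i} \<and>
        Phi p H = (\<lambda>n. Some (indicator A n))"
begin

definition D :: "nat \<Rightarrow> nat \<Rightarrow> nat \<Rightarrow> bool" where "D y z v \<longleftrightarrow> d {y, z} = Some v"
definition lim :: "nat \<Rightarrow> nat" where "lim x = (SOME c. \<forall>\<^sub>F y in sequentially. d {x, y} = Some c)"
definition G :: "nat \<Rightarrow> nat \<Rightarrow> bool" where "G y v \<longleftrightarrow> v = lim y"
abbreviation q :: nat where "q \<equiv> pe k (pe a p)"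
abbreviation e :: "nat \<Rightarrow> nat" where "e \<equiv> coloring q"
definition \<theta> :: "nat \<Rightarrow> nat" where "\<theta> s = pe q (pe s (history (next_color q) s))"
abbreviation u :: "nat \<Rightarrow> nat" where "u s \<equiv> known (\<theta> s)"
abbreviation lev :: "nat \<Rightarrow> nat \<Rightarrow> nat" where
  "lev s \<equiv> level (u s) (col_at (\<theta> s)) (guess (\<theta> s)) (past (\<theta> s)) k p"

lemma D_ex: "y < z \<Longrightarrow> \<exists>v<k. D y z v"
proof -
  assume "y < z"
  then have "{y, z} \<in> nsets UNIV 2" by (auto simp: nsets_def)
  then have "{y, z} \<in> dom d" using tot by (simp only: total_coloring_def)
  then obtain v where "d {y, z} = Some v" by blast
  moreover then have "v < k" using pc by (auto simp: partial_coloring_def intro: ranI)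
  ultimately show ?thesis by (auto simp: D_def)
qed

lemma lim: "\<forall>\<^sub>F z in sequentially. D y z (lim y)"
proof -
  have "\<exists>c. \<forall>\<^sub>F z in sequentially. d {y, z} = Some c"
    using stab unfolding stable_coloring_def by blast
  then show ?thesis unfolding D_def lim_def by (rule someI_ex)
qed

lemma lim_less: "lim y < k"
proof -
  have "\<forall>\<^sub>F z in sequentially. D y z (lim y) \<and> y < z"
    using lim eventually_gt_at_top by (rule eventually_conj)
  then obtain z where "D y z (lim y)" "y < z" using eventually_happens by fastforce
  then show ?thesis using D_ex[of y z] by (auto simp: D_def)
qed

lemma col_at_sound: "col_at (\<theta> s) y z v \<Longrightarrow> y < z \<Longrightarrow> D y z v"
  using table_sound[of "{}" _ a "pe y z" v] ci
  by (auto simp: col_at_def \<theta>_def D_def coloring_index_def Phi_def)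

lemma col_at_complete: "y < z \<Longrightarrow> D y z v \<Longrightarrow> \<forall>\<^sub>F s in sequentially. col_at (\<theta> s) y z v"
proof -
  assume "y < z" "D y z v"
  then have "run {} (decode a) (pe y z) = Some v"
    using ci by (simp add: D_def coloring_index_def Phi_def)
  then obtain T where T: "finite T" "table {} T" "pe a (pe (pe y z) v) \<in> T"
    using table_complete unfolding tabulated_def by blast
  show ?thesis
    using eventually_gt_at_top[of "set_encode T"]
    by eventually_elim (use T in \<open>auto simp: col_at_def \<theta>_def intro!: exI[of _ "set_encode T"]\<close>)
qed

lemma known_le: "u s \<le> s"
  unfolding known_def by (rule Least_le) (simp add: \<theta>_def)

text \<open>Some color has been found for the pair; by soundness it is the color given by
  \<open>d\<close>, so \<open>col_at\<close> is exact in both directions.\<close>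

lemma col_at_known: assumes "y < z" "z \<le> u s" shows "col_at (\<theta> s) y z v \<longleftrightarrow> D y z v"
proof -
  obtain z' where z: "z = Suc z'" using assms by (cases z) auto
  then have "z' < u s" using assms by simp
  from not_less_Least[OF this[unfolded known_def]] assms obtain v' where "col_at (\<theta> s) y z v'"
    by (auto simp: z)
  then show ?thesis using col_at_sound assms(1) by (fastforce simp: D_def)
qed

lemma known_tendsto: "\<forall>\<^sub>F s in sequentially. n \<le> u s"
proof -
  have "\<forall>\<^sub>F s in sequentially. \<forall>z\<in>{..n}. \<forall>y\<in>{..<z}. \<exists>v<k. col_at (\<theta> s) y z v"
  proof (intro eventually_ball_finite ballI)
    fix z y :: nat assume "y \<in> {..<z}"
    then obtain v where "y < z" "v < k" "D y z v" using D_ex by auto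
    from col_at_complete[OF this(1,3)]
    show "\<forall>\<^sub>F s in sequentially. \<exists>v<k. col_at (\<theta> s) y z v"
      by eventually_elim (use \<open>v < k\<close> in auto)
  qed auto
  then show ?thesis using eventually_ge_at_top[of n]
  proof eventually_elim
    case (elim s)
    \<comment> \<open>If \<open>u s < n\<close>, then the first alternative contradicts
      \<open>n \<le> s\<close>, and the second contradicts the completeness of the rows up to
      \<open>n\<close>.\<close>
    have "s \<le> u s \<or> \<not> (\<forall>x<Suc (u s). \<exists>v<k. col_at (\<theta> s) x (Suc (u s)) v)"
      unfolding known_def
      by (rule LeastI2[of _ s]) (auto simp: \<theta>_def)
    with elim show ?case by (cases "n \<le> u s") auto
  qed
qed

lemma past_eq: "x < s \<Longrightarrow> past (\<theta> s) x = e x"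
  by (simp add: past_def \<theta>_def look_history coloring_def)

text \<open>By stability the colors of finitely many points are final from some column on, and the
  column \<open>u s\<close> from which guesses are read eventually passes it.\<close>

lemma guess_eq: "\<forall>\<^sub>F s in sequentially. \<forall>y<n. \<forall>v. guess (\<theta> s) y v \<longleftrightarrow> G y v"
proof -
  have "\<forall>\<^sub>F z in sequentially. \<forall>y\<in>{..<n}. D y z (lim y)"
    by (intro eventually_ball_finite ballI lim) auto
  then obtain M where M: "\<And>y z. y < n \<Longrightarrow> M \<le> z \<Longrightarrow> D y z (lim y)"
    by (auto simp: eventually_sequentially)
  show ?thesis using known_tendsto[of "M + Suc n"]
  proof eventually_elim
    case (elim s)
    have "guess (\<theta> s) y v \<longleftrightarrow> G y v" if "y < n" for y v
      using col_at_known[of y "u s" s v] M[of y "u s"] elim that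
      by (auto simp: guess_def D_def G_def)
    then show ?case by blast
  qed
qed

lemma coloring_eq: "e s = color (u s) (col_at (\<theta> s)) (guess (\<theta> s)) (past (\<theta> s)) k p"
  by (simp add: coloring_def next_color_def Let_def \<theta>_def)

lemma digit_coloring: "l < k \<Longrightarrow> digit k l (e s) = srnd (lev s l) mod Suc k"
  unfolding coloring_eq color_def by (rule digit_sum)

section \<open>Convergence of the levels\<close>

abbreviation init :: nat where "init \<equiv> pe 0 (pe 0 0)"
abbreviation sstep :: "nat \<Rightarrow> nat \<Rightarrow> (nat \<Rightarrow> nat) \<Rightarrow> nat \<Rightarrow> nat" where
  "sstep s l S \<equiv> step (u s) (col_at (\<theta> s)) (guess (\<theta> s)) (past (\<theta> s)) k p l S"

text \<open>Pair colors and values of \<open>e\<close> below \<open>t\<close> are exact when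
  \<open>t \<le> u s\<close>. Limit colors enter only below the finitely many bounds
  \<open>sbd (S i)\<close>, where the guesses settle. So one stage works for all
  \<open>t \<le> u s\<close>.\<close>

lemma barren_upto_limit:
  "\<forall>\<^sub>F s in sequentially. \<forall>t\<le>u s.
     barren_upto (col_at (\<theta> s)) (guess (\<theta> s)) (past (\<theta> s)) k p l S t \<longleftrightarrow> barren_upto D G e k p l S t"
proof -
  define n where "n = (\<Sum>i<Suc l. sbd (S i))"
  have n: "sbd (S i) \<le> n" if "i < Suc l" for i
    unfolding n_def by (rule member_le_sum) (use that in auto)
  show ?thesis using guess_eq[of n]
  proof eventually_elim
    case (elim s)
    have "barren (col_at (\<theta> s)) (guess (\<theta> s)) (past (\<theta> s)) k p i (S i) N t \<longleftrightarrow> barren D G e k p i (S i) N t"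
      if "t \<le> u s" "i < Suc l" for t i N
    proof (rule barren_cong)
      show "col_at (\<theta> s) y z v \<longleftrightarrow> D y z v" if "y < z" "z < t" for y z v
        using col_at_known that \<open>t \<le> u s\<close> by simp
      show "guess (\<theta> s) x v \<longleftrightarrow> G x v" if "x < sbd (S i)" for x v
        using elim n[OF \<open>i < Suc l\<close>] that by simp
      show "past (\<theta> s) x = e x" if "x < t" for x
        using that \<open>t \<le> u s\<close> known_le[of s] by (intro past_eq) simp
    qed auto
    then show ?case by (simp add: barren_upto_def)
  qed
qed

lemma enlarge_limit:
  "\<forall>\<^sub>F s in sequentially. enlarge (col_at (\<theta> s)) (guess (\<theta> s)) (past (\<theta> s)) k p l \<sigma> t = enlarge D G e k p l \<sigma> t"
  using guess_eq[of "sbd \<sigma> + t"] known_tendsto[of t]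
proof eventually_elim
  case (elim s)
  have "witness (col_at (\<theta> s)) (past (\<theta> s)) k p l \<sigma> w \<longleftrightarrow> witness D e k p l \<sigma> w" if "w < t" for w
  proof (rule witness_cong)
    show "col_at (\<theta> s) y z v \<longleftrightarrow> D y z v" if "y < z" "z < w" for y z v
      using col_at_known that \<open>w < t\<close> elim by simp
    show "past (\<theta> s) (wval w) = e (wval w)"
      using that elim known_le[of s] witness_code_bounds(3)[of w] by (intro past_eq) simp
  qed
  moreover have "fits (guess (\<theta> s)) \<sigma> w \<longleftrightarrow> fits G \<sigma> w" if "w < t" for w
    by (rule fits_cong) (use elim that in auto)
  ultimately have "(t \<le> w \<or> witness (col_at (\<theta> s)) (past (\<theta> s)) k p l \<sigma> w \<and> fits (guess (\<theta> s)) \<sigma> w) \<longleftrightarrow>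
      (t \<le> w \<or> witness D e k p l \<sigma> w \<and> fits G \<sigma> w)" for w
    by (meson not_le)
  then show ?case unfolding enlarge_def by simp
qed

abbreviation B :: "nat \<Rightarrow> (nat \<Rightarrow> nat) \<Rightarrow> nat \<Rightarrow> nat \<Rightarrow> bool" where
  "B l S \<sigma> \<equiv> barren_upto D G e k p l (\<lambda>i. if i = l then \<sigma> else S i)"

definition stuck :: "nat \<Rightarrow> (nat \<Rightarrow> nat) \<Rightarrow> nat \<Rightarrow> bool" where
  "stuck l S \<sigma> \<longleftrightarrow> (\<forall>t>sbd \<sigma>. B l S \<sigma> t)"

definition nxt :: "nat \<Rightarrow> (nat \<Rightarrow> nat) \<Rightarrow> nat \<Rightarrow> nat" where
  "nxt l S \<sigma> = (LEAST t. sbd \<sigma> < t \<and> \<not> B l S \<sigma> t)"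

text \<open>The run of level \<open>l\<close> on the true data, with the lower levels frozen at
  \<open>S\<close>.\<close>

definition \<tau> :: "nat \<Rightarrow> (nat \<Rightarrow> nat) \<Rightarrow> nat \<Rightarrow> nat" where
  "\<tau> l S n = ((\<lambda>\<sigma>. enlarge D G e k p l \<sigma> (nxt l S \<sigma>)) ^^ n) init"

lemma tau_0: "\<tau> l S 0 = init"
  and tau_Suc: "\<tau> l S (Suc n) = enlarge D G e k p l (\<tau> l S n) (nxt l S (\<tau> l S n))"
  by (simp_all add: \<tau>_def)

lemma nxt:
  assumes "\<not> stuck l S \<sigma>" shows "sbd \<sigma> < nxt l S \<sigma>" "\<not> B l S \<sigma> (nxt l S \<sigma>)"
proof -
  obtain t where "sbd \<sigma> < t \<and> \<not> B l S \<sigma> t" using assms by (auto simp: stuck_def)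
  then have "sbd \<sigma> < nxt l S \<sigma> \<and> \<not> B l S \<sigma> (nxt l S \<sigma>)" unfolding nxt_def by (rule LeastI)
  then show "sbd \<sigma> < nxt l S \<sigma>" "\<not> B l S \<sigma> (nxt l S \<sigma>)" by blast+
qed

text \<open>At late stages the search receives true answers up to \<open>u s\<close>, and
  \<open>u s\<close> has passed the true end of the round.\<close>

lemma sstep_limit:
  assumes "\<not> stuck l S \<sigma>"
  shows "\<forall>\<^sub>F s in sequentially. sstep s l S \<sigma> = enlarge D G e k p l \<sigma> (nxt l S \<sigma>)"
  using barren_upto_limit[of l "\<lambda>i. if i = l then \<sigma> else S i"] known_tendsto[of "nxt l S \<sigma>"]
    enlarge_limit[of l \<sigma> "nxt l S \<sigma>"]
proof eventually_elim
  case (elim s)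
  let ?B = "barren_upto (col_at (\<theta> s)) (guess (\<theta> s)) (past (\<theta> s)) k p l (\<lambda>i. if i = l then \<sigma> else S i)"
  have "(LEAST t. sbd \<sigma> < t \<and> (u s < t \<or> \<not> ?B t)) = nxt l S \<sigma>"
  proof (rule Least_equality)
    show "sbd \<sigma> < nxt l S \<sigma> \<and> (u s < nxt l S \<sigma> \<or> \<not> ?B (nxt l S \<sigma>))"
      using nxt[OF assms] elim by blast
  next
    fix t assume t: "sbd \<sigma> < t \<and> (u s < t \<or> \<not> ?B t)"
    show "nxt l S \<sigma> \<le> t"
    proof (cases "u s < t")
      case False
      then have "sbd \<sigma> < t \<and> \<not> B l S \<sigma> t" using t elim(1) by (meson not_le)
      then show ?thesis unfolding nxt_def by (rule Least_le)
    qed (use elim in simp)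
  qed
  then show ?case using elim by (simp add: step_def)
qed

lemma sstep_stuck:
  assumes "stuck l S \<sigma>"
  shows "\<forall>\<^sub>F s in sequentially. sstep s l S \<sigma> = \<sigma>"
  using barren_upto_limit[of l "\<lambda>i. if i = l then \<sigma> else S i"]
proof eventually_elim
  case (elim s)
  let ?B = "barren_upto (col_at (\<theta> s)) (guess (\<theta> s)) (past (\<theta> s)) k p l (\<lambda>i. if i = l then \<sigma> else S i)"
  define t where "t = (LEAST t. sbd \<sigma> < t \<and> (u s < t \<or> \<not> ?B t))"
  have "sbd \<sigma> < Suc (sbd \<sigma> + u s) \<and> (u s < Suc (sbd \<sigma> + u s) \<or> \<not> ?B (Suc (sbd \<sigma> + u s)))" by simp
  then have t: "sbd \<sigma> < t \<and> (u s < t \<or> \<not> ?B t)" unfolding t_def by (rule LeastI)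
  then have "u s < t" using elim assms unfolding stuck_def by (meson not_le)
  then show ?case by (simp add: step_def flip: t_def)
qed

lemma iterate_limit:
  assumes "\<And>m. m < n \<Longrightarrow> \<not> stuck l S (\<tau> l S m)"
  shows "\<forall>\<^sub>F s in sequentially. (sstep s l S ^^ n) init = \<tau> l S n"
  using assms
proof (induction n)
  case (Suc n)
  then have "\<forall>\<^sub>F s in sequentially. (sstep s l S ^^ n) init = \<tau> l S n" by simp
  then show ?case using sstep_limit[OF Suc.prems[of n, OF lessI]]
    by eventually_elim (simp add: tau_Suc)
qed (simp add: tau_0)

text \<open>Once the lower levels have settled, the path makes the \<open>n\<close> true steps, and
  the stuck state is a fixed point of all remaining ones.\<close>

lemma level_limit:
  assumes "\<And>i. i < l \<Longrightarrow> \<forall>\<^sub>F s in sequentially. lev s i = S i"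
    and "\<And>m. m < n \<Longrightarrow> \<not> stuck l S (\<tau> l S m)" and "stuck l S (\<tau> l S n)"
  shows "\<forall>\<^sub>F s in sequentially. lev s l = \<tau> l S n"
proof -
  have "\<forall>\<^sub>F s in sequentially. \<forall>i\<in>{..<l}. lev s i = S i"
    by (intro eventually_ball_finite ballI) (use assms(1) in auto)
  moreover have "\<forall>\<^sub>F s in sequentially. (sstep s l S ^^ n) init = \<tau> l S n"
    by (rule iterate_limit) (rule assms(2))
  ultimately show ?thesis
    using sstep_stuck[OF assms(3)] known_tendsto[of n]
  proof eventually_elim
    case (elim s)
    have fixp: "(sstep s l S ^^ j) (\<tau> l S n) = \<tau> l S n" for j
      by (induction j) (simp_all add: elim)
    have "lev s l = path (u s) (col_at (\<theta> s)) (guess (\<theta> s)) (past (\<theta> s)) k p l (lev s)"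
      by (rule level_eq)
    also have "\<dots> = path (u s) (col_at (\<theta> s)) (guess (\<theta> s)) (past (\<theta> s)) k p l S"
      by (rule path_cong) (use elim in auto)
    also have "\<dots> = (sstep s l S ^^ (u s - n + n)) init" using elim by (simp add: path_def)
    also have "\<dots> = \<tau> l S n" by (simp only: funpow_add comp_apply elim fixp)
    finally show ?case .
  qed
qed

text \<open>The invariant of the construction: for each \<open>j\<close>, the points of the state
  with limit color \<open>j\<close> form a homogeneous set of color \<open>j\<close>.\<close>

definition good :: "nat \<Rightarrow> bool" where
  "good \<sigma> \<longleftrightarrow> (\<forall>y\<in>sset \<sigma>. \<forall>z\<in>sset \<sigma>. y < z \<longrightarrow> z < sbd \<sigma> \<longrightarrow> lim y = lim z \<longrightarrow> D y z (lim y))"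

lemma sbd_enlarge [simp]: "sbd (enlarge C G' e' k' p' l \<sigma> t) = t"
  and srnd_enlarge [simp]: "srnd (enlarge C G' e' k' p' l \<sigma> t) = Suc (srnd \<sigma>)"
  by (simp_all add: enlarge_def Let_def)

lemma enlarge_cases:
  obtains
    (none) "sset (enlarge D G e k p l \<sigma> t) = {y. y < t \<and> y \<in> sset \<sigma> \<and> y < sbd \<sigma>}"
      "\<And>w. w < t \<Longrightarrow> \<not> (witness D e k p l \<sigma> w \<and> fits G \<sigma> w)"
  | (wit) w where "w < t" "witness D e k p l \<sigma> w" "fits G \<sigma> w"
      "sset (enlarge D G e k p l \<sigma> t) = {y. y < t \<and> (y \<in> sset \<sigma> \<and> y < sbd \<sigma> \<or> y \<in> wset w)}"
proof -
  define w where "w = (LEAST w. t \<le> w \<or> witness D e k p l \<sigma> w \<and> fits G \<sigma> w)"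
  \<comment> \<open>A value of at least \<open>t\<close> is the default, meaning that no fitting
    witness was found.\<close>
  have w: "t \<le> w \<or> witness D e k p l \<sigma> w \<and> fits G \<sigma> w"
    unfolding w_def by (rule LeastI[of _ t]) simp
  have E: "sset (enlarge D G e k p l \<sigma> t) = {y. y < t \<and> (y \<in> sset \<sigma> \<and> y < sbd \<sigma> \<or> w < t \<and> y \<in> wset w)}"
    by (simp add: enlarge_def flip: w_def)
  show thesis
  proof (cases "w < t")
    case True
    then show ?thesis using w E by (intro wit[of w]) auto
  next
    case False
    have "\<not> (witness D e k p l \<sigma> w' \<and> fits G \<sigma> w')" if "w' < t" for w'
      using not_less_Least[of w' "\<lambda>w. t \<le> w \<or> witness D e k p l \<sigma> w \<and> fits G \<sigma> w"] that False
      unfolding w_def by (meson less_le_trans not_le)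
    then show ?thesis using E False by (intro none) auto
  qed
qed

text \<open>Points of limit color \<open>wcol w\<close> all lie in the homogeneous oracle of the
  witness. Points of other limit colors are old, because \<open>fits G\<close> adds none.\<close>

lemma good_enlarge: assumes "good \<sigma>" shows "good (enlarge D G e k p l \<sigma> t)"
proof (cases rule: enlarge_cases[of l \<sigma> t])
  case none
  then show ?thesis using assms unfolding good_def none(1) sbd_enlarge by auto
next
  case (wit w)
  have old: "y \<in> wset w \<longleftrightarrow> y \<in> sset \<sigma> \<and> lim y = wcol w" if "y < sbd \<sigma>" for y
    using wit(3) that by (auto simp: fits_def G_def)
  have new: "lim y = wcol w" if "y \<in> wset w" for y
    using wit(3) that by (auto simp: fits_def G_def)
  have hom: "D y z (wcol w)" if "y \<in> wset w" "z \<in> wset w" "y < z" for y z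
    using wit(2) that by (auto simp: witness_def)
  show ?thesis
    unfolding good_def wit(4) sbd_enlarge
  proof (intro ballI impI)
    fix y z
    assume y: "y \<in> {y. y < t \<and> (y \<in> sset \<sigma> \<and> y < sbd \<sigma> \<or> y \<in> wset w)}"
      and z: "z \<in> {y. y < t \<and> (y \<in> sset \<sigma> \<and> y < sbd \<sigma> \<or> y \<in> wset w)}"
      and yz: "y < z" "lim y = lim z"
    show "D y z (lim y)"
    proof (cases "lim y = wcol w")
      case True
      then have "y \<in> wset w" "z \<in> wset w" using y z yz old by auto
      then show ?thesis using hom yz True by simp
    next
      case False
      then have "y \<in> sset \<sigma>" "z \<in> sset \<sigma>" "z < sbd \<sigma>" using y z yz new by auto
      then show ?thesis using assms yz by (auto simp: good_def)
    qed
  qed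
qed

lemma good_tau: "good (\<tau> l S n)"
  by (induction n) (simp_all add: tau_0 tau_Suc good_enlarge, simp add: good_def)

lemma homogeneousI:
  assumes "\<And>y z. y \<in> H \<Longrightarrow> z \<in> H \<Longrightarrow> y < z \<Longrightarrow> D y z j"
  shows "homogeneous d H"
  unfolding homogeneous_def
proof (intro exI[of _ j] ballI)
  fix s assume "s \<in> nsets H 2"
  then obtain y z where "s = {y, z}" "y \<in> H" "z \<in> H" "y \<noteq> z"
    by (auto simp: nsets_def card_2_iff)
  then show "d s = Some j"
    using assms[of y z] assms[of z y] by (cases "y < z") (auto simp: D_def insert_commute)
qed

text \<open>Ramsey's theorem gives a homogeneous subset of some color. This color must be
  \<open>j\<close>, because a fixed point of the subset has color \<open>j\<close> with almost all
  later points.\<close>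

lemma infinite_limit_homogeneous:
  assumes "infinite Z" "\<And>z. z \<in> Z \<Longrightarrow> lim z = j"
  obtains Y where "Y \<subseteq> Z" "infinite Y" "\<And>y z. y \<in> Y \<Longrightarrow> z \<in> Y \<Longrightarrow> y < z \<Longrightarrow> D y z j"
proof -
  have "\<forall>y\<in>Z. \<forall>z\<in>Z. y \<noteq> z \<longrightarrow> the (d {y, z}) < k"
  proof (intro ballI impI)
    fix y z :: nat assume "y \<noteq> z"
    then consider "y < z" | "z < y" by linarith
    then show "the (d {y, z}) < k"
      using D_ex[of y z] D_ex[of z y] by cases (auto simp: D_def insert_commute)
  qed
  from Ramsey2[OF assms(1) this] obtain Y c where Y: "Y \<subseteq> Z" "infinite Y"
    and c: "\<forall>y\<in>Y. \<forall>z\<in>Y. y \<noteq> z \<longrightarrow> the (d {y, z}) = c" by blast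
  have D: "D y z c" if "y \<in> Y" "z \<in> Y" "y < z" for y z
    using D_ex[OF that(3)] c that by (fastforce simp: D_def)
  have "Y \<noteq> {}" using Y(2) by auto
  then obtain y where "y \<in> Y" by blast
  obtain M where M: "\<And>z. M \<le> z \<Longrightarrow> D y z (lim y)"
    using lim[of y] by (auto simp: eventually_sequentially)
  obtain z where "z \<in> Y" "M + Suc y \<le> z"
    using Y(2) by (meson infinite_nat_iff_unbounded_le)
  then have "c = lim y" using D[OF \<open>y \<in> Y\<close>, of z] M[of z] by (auto simp: D_def)
  then have "c = j" using assms(2) Y(1) \<open>y \<in> Y\<close> by auto
  then show thesis using that[OF Y] D by blast
qed

section \<open>Outcomes of a level and the contradiction\<close>

lemma table_win:
  assumes "table H T" "pe p (pe x 1) \<in> T" "Phi p H = (\<lambda>n. Some (indicator A n))"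
  shows "x \<in> A"
  using table_sound[OF assms(1,2)] assms(3)
  by (cases "x \<in> A") (auto simp: Phi_def dest: fun_cong[of _ _ x])

text \<open>If \<open>N i\<close> were right infinitely often, then it would be right for infinitely
  many points of one limit color \<open>j\<close>. Some of these extend the current set of color
  \<open>j\<close> to an infinite homogeneous \<open>H\<close>. The infinite set computed from
  \<open>H\<close> has points beyond the stage where level \<open>i\<close> settles, and there digit
  \<open>i\<close> is the desired one. A finite part of \<open>H\<close> then gives a witness
  against barrenness.\<close>

lemma barren_agree_finite:
  assumes "i < k" "good \<sigma>" and lev: "\<forall>\<^sub>F s in sequentially. lev s i = \<sigma>"
    and barren: "\<And>t. barren D G e k p i \<sigma> N t"
  shows "finite {x. N i x (lim x)}"
proof (rule ccontr)
  assume inf: "infinite {x. N i x (lim x)}"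
  have "{x. N i x (lim x)} = (\<Union>j<k. {x. lim x = j \<and> N i x j})" using lim_less by auto
  with inf obtain j where "j < k" and infj: "infinite {x. lim x = j \<and> N i x j}" by auto
  define b where "b = sbd \<sigma>"
  have N_old: "N i y v \<longleftrightarrow> v = lim y" if "y < b" "v < k" for y v
    using barren[of "Suc y"] that unfolding barren_def b_def G_def by blast
  define F where "F = {y\<in>sset \<sigma>. y < b \<and> lim y = j}"
  have "\<forall>\<^sub>F z in sequentially. \<forall>y\<in>F. D y z (lim y)"
    by (intro eventually_ball_finite ballI lim) (simp add: F_def)
  then obtain M where M: "\<And>y z. y \<in> F \<Longrightarrow> M \<le> z \<Longrightarrow> D y z j"
    by (auto simp: eventually_sequentially F_def)
  \<comment> \<open>From \<open>M\<close> on, every point of \<open>F\<close> shows its limit color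
    \<open>j\<close>, so \<open>F\<close> can be joined to a homogeneous set chosen there.\<close>
  have "infinite ({x. lim x = j \<and> N i x j} - {..<b + M})" using infj by simp
  then obtain Y where Y: "Y \<subseteq> {x. lim x = j \<and> N i x j} - {..<b + M}" "infinite Y"
    and homY: "\<And>y z. y \<in> Y \<Longrightarrow> z \<in> Y \<Longrightarrow> y < z \<Longrightarrow> D y z j"
    by (rule infinite_limit_homogeneous[where j = j]) auto
  have Y_props: "b + M \<le> z \<and> lim z = j \<and> N i z j" if "z \<in> Y" for z using Y(1) that by auto
  define H where "H = F \<union> Y"
  have below: "y \<in> H \<longleftrightarrow> y \<in> F" if "y < b" for y using that Y(1) by (auto simp: H_def)
  have homH: "D y z j" if yz: "y \<in> H" "z \<in> H" "y < z" for y z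
  proof -
    consider "y \<in> F" "z \<in> F" | "y \<in> F" "M \<le> z" | "y \<in> Y" "z \<in> Y"
      using yz Y_props[of y] Y_props[of z] by (fastforce simp: H_def F_def)
    then show ?thesis
    proof cases
      case 1
      then have "y \<in> sset \<sigma>" "z \<in> sset \<sigma>" "z < sbd \<sigma>" "lim y = j" "lim z = j"
        by (auto simp: F_def b_def)
      then show ?thesis using assms(2) \<open>y < z\<close> unfolding good_def by metis
    qed (use M homY \<open>y < z\<close> in auto)
  qed
  have NH: "N i y j" if "y \<in> H" for y
    using that Y(1) N_old[of y j] \<open>j < k\<close> by (auto simp: H_def F_def)
  have "infinite H" using Y(2) by (simp add: H_def)
  from nowin[OF this homogeneousI[OF homH]] obtain A c
    where A: "infinite A" "Phi p H = (\<lambda>n. Some (indicator A n))" by blast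
  obtain M' where M': "\<And>s. M' \<le> s \<Longrightarrow> lev s i = \<sigma>"
    using lev by (auto simp: eventually_sequentially)
  obtain x where x: "x \<in> A" "b + M' \<le> x" using A(1) by (meson infinite_nat_iff_unbounded_le)
  then have "run H (decode p) x = Some 1" using fun_cong[OF A(2), of x] by (simp add: Phi_def)
  then obtain T where T: "finite T" "table H T" "pe p (pe x 1) \<in> T"
    using table_complete unfolding tabulated_def by blast
  have "Y \<noteq> {}" using Y(2) by auto
  then obtain h where h: "h \<in> Y" by blast
  \<comment> \<open>Cutting \<open>H\<close> at \<open>r\<close> preserves the computation, since
    \<open>r\<close> exceeds the table. It also keeps all of \<open>F\<close> and the point
    \<open>h\<close>, the new point demanded by \<open>fits\<close>.\<close>
  define r where "r = Suc (h + b + set_encode T)"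
  define X where "X = {y\<in>H. y < r}"
  have "finite X" by (simp add: X_def)
  define w where "w = pe j (pe (set_encode X) (pe (set_encode T) x))"
  have w: "wset w = X" "wtab w = T" "wval w = x" "wcol w = j"
    using \<open>finite X\<close> T(1) by (simp_all add: w_def)
  have "table X T"
  proof (rule table_use[OF T(2)])
    show "z < r" if "z \<in> T" for z
      using that set_decode_less[of z "set_encode T"] T(1) by (simp add: r_def)
  qed (auto simp: X_def)
  then have "witness D e k p i \<sigma> w"
    unfolding witness_def w using \<open>j < k\<close> homH T(3) x M'[of x] digit_coloring[OF assms(1), of x]
    by (auto simp: X_def b_def)
  moreover have "fits (N i) \<sigma> w"
    unfolding fits_def w
  proof (intro conjI ballI allI impI)
    fix y assume "y < sbd \<sigma>"
    then show "y \<in> X \<longleftrightarrow> y \<in> sset \<sigma> \<and> N i y j"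
      using below[of y] N_old[of y j] \<open>j < k\<close> by (auto simp: X_def F_def b_def r_def)
  next
    show "N i y j" if "y \<in> X" for y using NH that by (simp add: X_def)
  next
    show "\<exists>y\<in>X. sbd \<sigma> \<le> y" using h Y(1) by (intro bexI[of _ h]) (auto simp: X_def H_def r_def b_def)
  qed
  ultimately show False using barren[of "Suc w"] unfolding barren_def by blast
qed

text \<open>If all rounds ended, then almost every round would provide a witness that fits the true
  limit colors. For each color \<open>j\<close> used infinitely often, the set computed from
  \<open>H j\<close> is almost homogeneous, which fixes the residue of late rounds using
  \<open>j\<close>. But \<open>k\<close> colors cannot account for \<open>k + 1\<close>
  residues.\<close>

lemma eventually_stuck:
  assumes "l < k" and barren: "\<And>i t. i < l \<Longrightarrow> barren D G e k p i (S i) N t"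
    and disagree: "\<And>i. i < l \<Longrightarrow> finite {x. N i x (lim x)}"
  shows "\<exists>n. stuck l S (\<tau> l S n)"
proof (rule ccontr)
  assume "\<not> ?thesis"
  then have ns: "\<not> stuck l S (\<tau> l S n)" for n by blast
  define b where "b n = sbd (\<tau> l S n)" for n
  have b_Suc: "b (Suc n) = nxt l S (\<tau> l S n)" for n by (simp add: b_def tau_Suc)
  have b_less: "b n < b (Suc n)" for n using nxt(1)[OF ns[of n]] by (simp add: b_def tau_Suc)
  have n_le_b: "n \<le> b n" for n
  proof (induction n)
    case (Suc n)
    then show ?case using b_less[of n] by simp
  qed simp
  have rnd: "srnd (\<tau> l S n) = n" for n by (induction n) (simp_all add: tau_0 tau_Suc)
  have "finite (\<Union>i<l. {x. N i x (lim x)})" using disagree by simp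
  then obtain b' where "\<forall>x\<in>(\<Union>i<l. {x. N i x (lim x)}). x < b'"
    unfolding finite_nat_set_iff_bounded by blast
  then have b': "\<not> N i x (lim x)" if "i < l" "b' \<le> x" for i x
    using that by (auto simp: not_less[symmetric])
  have ex: "\<exists>w<b (Suc n). witness D e k p l (\<tau> l S n) w \<and> fits G (\<tau> l S n) w" if "b' \<le> b n" for n
  proof (rule ccontr)
    assume none: "\<not> ?thesis"
    \<comment> \<open>The true limit colors take the place of level \<open>l\<close>. Past
      \<open>b'\<close> they avoid the lower partitions, so only a fitting witness can prevent
      barrenness.\<close>
    define N' where "N' i x v \<longleftrightarrow> (if i = l then v = lim x else N i x v)" for i x v
    have "N' l = G" by (intro ext) (simp add: N'_def G_def)
    have "barren D G e k p l (\<tau> l S n) N' (b (Suc n))"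
      unfolding barren_def \<open>N' l = G\<close>
    proof (intro conjI allI impI)
      show "\<exists>v<k. G x v" for x using lim_less by (auto simp: G_def)
      show "\<not> (G x v \<and> N' h x v)" if "sbd (\<tau> l S n) \<le> x" "h < l" for x v h
        using b'[of h x] that \<open>b' \<le> b n\<close> by (auto simp: G_def N'_def b_def)
    qed (use none in auto)
    moreover have "barren D G e k p i (S i) N' (b (Suc n))" if "i < l" for i
      using barren[OF that, of "b (Suc n)"] that
      by (subst barren_cong[where N' = N and C' = D and G' = G and e' = e]) (auto simp: N'_def)
    ultimately have "B l S (\<tau> l S n) (b (Suc n))"
      unfolding barren_upto_def by (intro exI[of _ N']) auto
    then show False using nxt(2)[OF ns] by (simp add: b_Suc)
  qed
  have "\<exists>w. w < b (Suc n) \<and> witness D e k p l (\<tau> l S n) w \<and> fits G (\<tau> l S n) w \<and>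
      sset (\<tau> l S (Suc n)) = {y. y < b (Suc n) \<and> (y \<in> sset (\<tau> l S n) \<and> y < b n \<or> y \<in> wset w)}"
    if bn: "b' \<le> b n" for n
  proof (cases rule: enlarge_cases[of l "\<tau> l S n" "b (Suc n)"])
    case none
    then show ?thesis using ex[OF bn] by blast
  next
    case (wit w)
    moreover have "enlarge D G e k p l (\<tau> l S n) (b (Suc n)) = \<tau> l S (Suc n)"
      by (simp only: tau_Suc b_Suc)
    ultimately show ?thesis unfolding b_def[of n] by (intro exI[of _ w]) simp
  qed
  then have "\<forall>n. \<exists>w. b' \<le> b n \<longrightarrow> w < b (Suc n) \<and> witness D e k p l (\<tau> l S n) w \<and> fits G (\<tau> l S n) w \<and>
      sset (\<tau> l S (Suc n)) = {y. y < b (Suc n) \<and> (y \<in> sset (\<tau> l S n) \<and> y < b n \<or> y \<in> wset w)}"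
    by blast
  from choice[OF this] obtain w where w:
    "\<forall>n. b' \<le> b n \<longrightarrow> w n < b (Suc n) \<and> witness D e k p l (\<tau> l S n) (w n) \<and> fits G (\<tau> l S n) (w n) \<and>
      sset (\<tau> l S (Suc n)) = {y. y < b (Suc n) \<and> (y \<in> sset (\<tau> l S n) \<and> y < b n \<or> y \<in> wset (w n))}" ..
  have w_less: "w n < b (Suc n)" and wit: "witness D e k p l (\<tau> l S n) (w n)"
    and fit: "fits G (\<tau> l S n) (w n)"
    and sset_Suc: "sset (\<tau> l S (Suc n)) =
       {y. y < b (Suc n) \<and> (y \<in> sset (\<tau> l S n) \<and> y < b n \<or> y \<in> wset (w n))}"
    if "b' \<le> b n" for n
    using w[rule_format, OF that] by blast+
  define E where "E n = {y\<in>sset (\<tau> l S n). y < b n}" for n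
  have E_Suc: "y \<in> E (Suc n) \<longleftrightarrow> y \<in> E n" if "y < b n" for y n
  proof (cases rule: enlarge_cases[of l "\<tau> l S n" "b (Suc n)"])
    case none
    then show ?thesis using that b_less[of n] by (simp add: E_def tau_Suc b_Suc b_def)
  next
    case (wit w)
    have "y \<in> wset w \<Longrightarrow> y \<in> sset (\<tau> l S n)"
      using wit(3) that by (simp add: fits_def b_def)
    then show ?thesis using that b_less[of n] wit(4) by (auto simp: E_def tau_Suc b_Suc b_def)
  qed
  have b_mono: "b m \<le> b n" if "m \<le> n" for m n
    using that by (rule lift_Suc_mono_le[of b, rotated]) (simp add: less_imp_le b_less)
  have E_later: "y \<in> E n \<longleftrightarrow> y \<in> E m" if "m \<le> n" "y < b m" for y m n
    using that(1)
  proof (induction rule: dec_induct)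
    case (step n)
    then show ?case using E_Suc[of y n] b_mono[of m n] that(2) by simp
  qed simp
  define H where "H j = {y. lim y = j \<and> (\<exists>n. y \<in> E n)}" for j
  have E_bd: "y < b n" if "y \<in> E n" for y n using that by (simp add: E_def)
  have H_below: "y \<in> H j \<longleftrightarrow> lim y = j \<and> y \<in> E n" if "y < b n" for y j n
  proof -
    have "y \<in> E n" if "y \<in> E m" for m
      using E_later[of m n y] E_later[of n m y] E_bd[OF that] \<open>y < b n\<close> that
      by (cases "m \<le> n") auto
    then show ?thesis by (auto simp: H_def)
  qed
  have homH: "D y z j" if yz: "y \<in> H j" "z \<in> H j" "y < z" for y z j
  proof -
    obtain n where n: "z \<in> E n" using yz(2) by (auto simp: H_def)
    have "lim y = j" "lim z = j" using yz by (auto simp: H_def)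
    moreover have "y \<in> E n" using H_below[of y n j] E_bd[OF n] yz by simp
    moreover from this n have "y \<in> sset (\<tau> l S n)" "z \<in> sset (\<tau> l S n)" "z < sbd (\<tau> l S n)"
      by (simp_all add: E_def b_def)
    ultimately show ?thesis using good_tau[of l S n] yz(3) unfolding good_def by metis
  qed
  have residue: "\<exists>M c. \<forall>n\<ge>M. wcol (w n) = j \<longrightarrow> n mod Suc k = c" for j
  proof (cases "infinite {n. wcol (w n) = j}")
    case False
    then obtain M where "\<forall>n\<in>{n. wcol (w n) = j}. n < M"
      unfolding not_not finite_nat_set_iff_bounded by blast
    \<comment> \<open>The condition is vacuous for late rounds, so 0 is an arbitrary choice.\<close>
    then have "\<forall>n\<ge>M. wcol (w n) = j \<longrightarrow> n mod Suc k = 0" by (auto simp flip: not_less)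
    then show ?thesis by blast
  next
    case True
    \<comment> \<open>Below the next bound the final set \<open>H j\<close> is the oracle of the
      witness of round \<open>n\<close>, so later rounds preserve the computation.\<close>
    have H_wset: "y \<in> H j \<longleftrightarrow> y \<in> wset (w n)"
      if "b' \<le> n" "wcol (w n) = j" "y < b (Suc n)" for n y
    proof -
      have "b' \<le> b n" using that(1) n_le_b[of n] by simp
      then show ?thesis
        using H_below[OF that(3), of j] fit[of n] sset_Suc[of n] that
        by (auto simp: E_def fits_def G_def b_def)
    qed
    have "infinite (H j)"
      unfolding infinite_nat_iff_unbounded_le
    proof
      fix m
      obtain n where n: "wcol (w n) = j" "b' + m \<le> n"
        using True by (auto simp: infinite_nat_iff_unbounded_le)
      have "b' \<le> b n" using n n_le_b[of n] by simp
      then obtain y where y: "y \<in> wset (w n)" "b n \<le> y" using fit[of n] by (auto simp: fits_def b_def)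
      have "y < b (Suc n)"
        using witness_code_bounds(1)[OF y(1)] w_less[OF \<open>b' \<le> b n\<close>] by simp
      then have "y \<in> H j" using H_wset[of n y] n y by simp
      then show "\<exists>y\<ge>m. y \<in> H j" using y(2) n n_le_b[of n] by (intro exI[of _ y]) simp
    qed
    from nowin[OF this homogeneousI[OF homH]] obtain A c where
      fin: "finite {x\<in>A. e x \<noteq> c}" and A: "Phi p (H j) = (\<lambda>n. Some (indicator A n))" by blast
    from fin obtain M where "\<forall>x\<in>{x\<in>A. e x \<noteq> c}. x < M"
      unfolding finite_nat_set_iff_bounded by blast
    then have M: "e x = c" if "x \<in> A" "M \<le> x" for x
      using that by (auto simp: not_less[symmetric])
    have "n mod Suc k = digit k l c" if n: "b' + M \<le> n" "wcol (w n) = j" for n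
    proof -
      have "b' \<le> b n" using n n_le_b[of n] by simp
      note wn = wit[OF this, unfolded witness_def]
      have "table (H j) (wtab (w n))"
      proof (rule table_use)
        show "table (wset (w n)) (wtab (w n))" using wn by blast
        show "z < b (Suc n)" if "z \<in> wtab (w n)" for z
          using witness_code_bounds(2)[OF that] w_less[OF \<open>b' \<le> b n\<close>] by simp
        show "y \<in> wset (w n) \<longleftrightarrow> y \<in> H j" if "y < b (Suc n)" for y
          using H_wset[of n y] that n by simp
      qed
      from table_win[OF this _ A] have "wval (w n) \<in> A" using wn by blast
      moreover have "M \<le> wval (w n)" using wn n n_le_b[of n] by (auto simp: b_def)
      ultimately have "e (wval (w n)) = c" by (rule M)
      then show ?thesis using wn rnd[of n] by simp
    qed
    then show ?thesis by blast
  qed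
  then obtain M c where Mc: "\<And>j n. M j \<le> n \<Longrightarrow> wcol (w n) = j \<Longrightarrow> n mod Suc k = c j" by metis
  define M' where "M' = b' + (\<Sum>j<k. M j)"
  have "{..<Suc k} \<subseteq> c ` {..<k}"
  proof
    fix r assume "r \<in> {..<Suc k}"
    \<comment> \<open>A round of residue \<open>r\<close> past all thresholds; its witness uses one
      of only \<open>k\<close> colors.\<close>
    define n where "n = r + Suc k * M'"
    have "M' \<le> n" by (simp add: n_def)
    then have "b' \<le> b n" using n_le_b[of n] by (simp add: M'_def)
    then have j: "wcol (w n) < k" using wit[of n] by (simp add: witness_def)
    then have "M (wcol (w n)) \<le> (\<Sum>j<k. M j)" by (intro member_le_sum) auto
    then have "n mod Suc k = c (wcol (w n))" using Mc \<open>M' \<le> n\<close> by (simp add: M'_def)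
    moreover have "n mod Suc k = r" using \<open>r \<in> {..<Suc k}\<close> by (simp add: n_def del: mult_Suc)
    ultimately show "r \<in> c ` {..<k}" using j by blast
  qed
  then have "card {..<Suc k} \<le> card (c ` {..<k})" by (intro card_mono) auto
  also have "\<dots> \<le> k" using card_image_le[of "{..<k}" c] by simp
  finally show False by simp
qed

text \<open>The two preceding lemmas alternate: barren partitions of the lower levels are wrong
  almost everywhere, which forces the next level to get stuck.\<close>

lemma all_levels_stuck:
  assumes "l \<le> k"
  shows "\<exists>S N. (\<forall>i<l. good (S i) \<and> (\<forall>\<^sub>F s in sequentially. lev s i = S i)) \<and>
    (\<forall>t. \<forall>i<l. barren D G e k p i (S i) N t)"
  using assms
proof (induction l)
  case (Suc l)
  then obtain S N where "\<forall>i<l. good (S i) \<and> (\<forall>\<^sub>F s in sequentially. lev s i = S i)"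
    and "\<forall>t. \<forall>i<l. barren D G e k p i (S i) N t"
    using Suc_leD by blast
  then have S: "good (S i)" "\<forall>\<^sub>F s in sequentially. lev s i = S i"
    and N: "barren D G e k p i (S i) N t" if "i < l" for i t
    using that by blast+
  have "\<exists>n. stuck l S (\<tau> l S n)"
  proof (rule eventually_stuck)
    show "l < k" using Suc.prems by simp
    show "barren D G e k p i (S i) N t" if "i < l" for i t using N that by blast
    show "finite {x. N i x (lim x)}" if "i < l" for i
      by (rule barren_agree_finite[of i "S i"]) (use that S N \<open>l < k\<close> in auto)
  qed
  then obtain n where n: "stuck l S (\<tau> l S n)" "\<And>m. m < n \<Longrightarrow> \<not> stuck l S (\<tau> l S m)"
    using exists_least_iff[of "\<lambda>n. stuck l S (\<tau> l S n)"] by blast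
  let ?S = "\<lambda>i. if i = l then \<tau> l S n else S i"
  \<comment> \<open>Compactness gives a new family for all levels up to \<open>l\<close>, which
    replaces \<open>N\<close>; only the lower states are retained.\<close>
  obtain N' where "\<forall>t. \<forall>i<Suc l. barren D G e k p i (?S i) N' t"
    using barren_upto_compact[of "sbd (\<tau> l S n)" D G e k p l ?S] n(1) unfolding stuck_def by blast
  moreover have "\<forall>\<^sub>F s in sequentially. lev s l = \<tau> l S n"
    by (rule level_limit) (use S n in auto)
  ultimately show ?case
    using S good_tau by (intro exI[of _ ?S] exI[of _ N']) (auto simp: less_Suc_eq)
qed auto

text \<open>At a far point the \<open>k\<close> levels choose pairwise different colors, which
  exhaust all \<open>k\<close> colors. One of them is the limit color, although far out every
  \<open>N i\<close> misses it.\<close>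

lemma contradiction: False
proof -
  obtain S N where "\<forall>i<k. good (S i) \<and> (\<forall>\<^sub>F s in sequentially. lev s i = S i)"
    and "\<forall>t. \<forall>i<k. barren D G e k p i (S i) N t"
    using all_levels_stuck[OF order_refl] by blast
  then have S: "good (S i)" "\<forall>\<^sub>F s in sequentially. lev s i = S i"
    and N: "barren D G e k p i (S i) N t" if "i < k" for i t
    using that by blast+
  have "finite (\<Union>i<k. {x. N i x (lim x)})"
    using barren_agree_finite S N by blast
  then obtain b where "\<forall>x\<in>(\<Union>i<k. {x. N i x (lim x)}). x < b"
    unfolding finite_nat_set_iff_bounded by blast
  then have b: "\<not> N i x (lim x)" if "i < k" "b \<le> x" for i x
    using that by (auto simp: not_less[symmetric])
  \<comment> \<open>Beyond every \<open>sbd (S i)\<close> the disjointness clauses of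
    \<open>barren\<close> apply.\<close>
  define x where "x = b + (\<Sum>i<k. sbd (S i))"
  have x: "sbd (S i) \<le> x" if "i < k" for i
  proof -
    have "sbd (S i) \<le> (\<Sum>i<k. sbd (S i))" by (rule member_le_sum) (use that in auto)
    then show ?thesis by (simp add: x_def)
  qed
  have "\<exists>v<k. N i x v" if "i < k" for i
    using N[OF that, of "Suc x"] by (auto simp: barren_def)
  then obtain f where f: "\<And>i. i < k \<Longrightarrow> f i < k \<and> N i x (f i)" by metis
  have disj: "f i \<noteq> f h" if ih: "i < k" "h < i" for i h
  proof -
    have "\<forall>v<k. \<not> (N i x v \<and> N h x v)"
      using N[OF ih(1), of "Suc x"] x[OF ih(1)] ih(2) unfolding barren_def by blast
    then show ?thesis using f[OF ih(1)] f[of h] ih by auto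
  qed
  have "inj_on f {..<k}"
    by (rule linorder_inj_onI) (use disj in \<open>auto dest: sym\<close>)
  moreover have "f ` {..<k} \<subseteq> {..<k}" using f by auto
  ultimately have "f ` {..<k} = {..<k}" by (simp add: endo_inj_surj)
  then obtain i where "i < k" "lim x = f i" using lim_less[of x] by (metis imageE lessThan_iff)
  then show False using f[of i] b[of i x] by (simp add: x_def)
qed

end

theorem theorem4p3:
  "\<exists>h :: nat \<Rightarrow> nat \<Rightarrow> nat \<Rightarrow> nat. computable3 h \<and>
     (\<forall>k\<ge>1. \<forall>(d :: nat set \<rightharpoonup> nat) a (\<Psi> :: nat set \<Rightarrow> nat \<rightharpoonup> nat) p.
        partial_coloring k d \<longrightarrow> coloring_index a d \<longrightarrow> turing_functional_index p \<Psi> \<longrightarrow>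
        (\<exists>e :: nat \<Rightarrow> nat.
           computable_index (h k a p) e \<and> range e \<subseteq> {..<sharp k} \<and>
           (total_coloring d \<and> stable_coloring d \<longrightarrow>
             (\<exists>H. infinite H \<and> homogeneous d H \<and>
                \<not> (\<exists>A. infinite A \<and> almost_homogeneous (sharp k) e A \<and>
                       \<Psi> H = (\<lambda>n. Some (indicator A n)))))))"
proof -
  obtain h where h: "recfn h" "\<And>b X n. Phi (h b) X n = Some (coloring b n)"
    using recfn_smn[OF recfn_coloring] by auto
  show ?thesis
  proof (intro exI[of _ "\<lambda>k a p. h (pe k (pe a p))"] conjI allI impI)
    show "computable3 (\<lambda>k a p. h (pe k (pe a p)))"
      using recfn_computable_index[OF h(1)] unfolding computable3_def by metis
  next
    fix k a p :: nat and d :: "nat set \<rightharpoonup> nat" and \<Psi> :: "nat set \<Rightarrow> nat \<rightharpoonup> nat"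
    assume d: "partial_coloring k d" "coloring_index a d" and p: "turing_functional_index p \<Psi>"
    let ?e = "coloring (pe k (pe a p))"
    have "\<exists>H. infinite H \<and> homogeneous d H \<and>
        \<not> (\<exists>A. infinite A \<and> almost_homogeneous (sharp k) ?e A \<and> \<Psi> H = (\<lambda>n. Some (indicator A n)))"
      if "total_coloring d" "stable_coloring d"
    proof (rule ccontr)
      assume "\<not> ?thesis"
      then have "no_win k a p d"
        using d p that unfolding no_win_def turing_functional_index_def almost_homogeneous_def by metis
      then show False by (rule no_win.contradiction)
    qed
    moreover have "?e x < sharp k" for x
      using order_less_le_trans[OF digit_sum_less power_le_sharp]
      by (simp add: coloring_def next_color_def color_def Let_def)
    ultimately show "\<exists>e. computable_index (h (pe k (pe a p))) e \<and> range e \<subseteq> {..<sharp k} \<and>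
      (total_coloring d \<and> stable_coloring d \<longrightarrow> (\<exists>H. infinite H \<and> homogeneous d H \<and>
        \<not> (\<exists>A. infinite A \<and> almost_homogeneous (sharp k) e A \<and> \<Psi> H = (\<lambda>n. Some (indicator A n)))))"
      using h(2) by (intro exI[of _ ?e]) (auto simp: computable_index_def)
  qed
qed

end
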